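(* Consider an ergodic Jackson network process $\mathbf{X}$ (setting in the context) whose extended routing matrix $r$ is reversible (with respect to $\eta$), with stationary distribution $\xi(\mathbf{n})=\prod_{j=1}^{J}\prod_{k=1}^{n_j}\frac{\eta_j}{\mu_j(k)}C(j)^{-1}$. Let $\boldsymbol{\gamma}=(\gamma_j:j\in\overline{J})\in[0,1]^{\overline{J}}$, define $\boldsymbol{\alpha}=(\alpha_j:j\in\overline{J}_0)$ by $\alpha_0=1$, $\alpha_j=\gamma_j$ for $j\in\overline{J}$, and let $r^{(\boldsymbol{\alpha})}$ be the randomized-reflection modification of $r$: $r^{(\boldsymbol{\alpha})}(i,j)=r(i,j)\alpha_j$ for $i\neq j$, $r^{(\boldsymbol{\alpha})}(i,i)=1-\sum_{j\ne i}r(i,j)\alpha_j$. Let $\mathbf{X}^{(\boldsymbol{\gamma})}$ be the continuous-time Markov chain on $\mathbb{N}_0^{\overline{J}}$ whose positive transition rates are $q(\mathbf{n},\mathbf{n}+\mathbf{e}_i)=\lambda r^{(\boldsymbol{\alpha})}(0,i)$ for $i\in\overline{J}$, $q(\mathbf{n},\mathbf{n}-\mathbf{e}_j+\mathbf{e}_i)=1_{[n_j>0]}\gamma_j\mu_j(n_j)r^{(\boldsymbol{\alpha})}(j,i)$ for $i,j\in\overline{J}$, $i\ne j$, and $q(\mathbf{n},\mathbf{n}-\mathbf{e}_j)=1_{[n_j>0]}\gamma_j\mu_j(n_j)r^{(\boldsymbol{\alpha})}(j,0)$ for $j\in\overline{J}$. Let $B(\boldsymbol{\gamma})=\{j\in\overline{J}:\gamma_j=0\}$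 and $W(\boldsymbol{\gamma})=\overline{J}\setminus B(\boldsymbol{\gamma})$. Then $\xi$ is a stationary distribution of $\mathbf{X}^{(\boldsymbol{\gamma})}$. If $B(\boldsymbol{\gamma})=\emptyset$, then $\mathbf{X}^{(\boldsymbol{\gamma})}$ is ergodic. If $B(\boldsymbol{\gamma})\neq\emptyset$, then $\mathbf{X}^{(\boldsymbol{\gamma})}$ is not irreducible on $\mathbb{N}_0^{\overline{J}}$, its state space splits into the infinitely many closed subspaces $\mathbb{N}_0^{W(\boldsymbol{\gamma})}\times\{(n_j:j\in B(\boldsymbol{\gamma}))\}$, $(n_j:j\in B(\boldsymbol{\gamma}))\in\mathbb{N}_0^{B(\boldsymbol{\gamma})}$, and for every probability distribution $\varphi$ on $\mathbb{N}_0^{B(\boldsymbol{\gamma})}$ the distribution \[ \xi^{(\boldsymbol{\gamma})}_\varphi(\mathbf{n})=\prod_{j\in W(\boldsymbol{\gamma})}\prod_{k=1}^{n_j}\frac{\eta_j}{\mu_j(k)}C(j)^{-1}\cdot\varphi(n_j:j\in B(\boldsymbol{\gamma})),\qquad \mathbf{n}\in\mathbb{N}_0^{\overline{J}}, \] is a stationary distribution of $\mathbf{X}^{(\boldsymbol{\gamma})}$.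
   Context: Jackson network setting: node set $\overline{J}=\{1,\dots,J\}$, extended node set $\overline{J}_0=\{0,1,\dots,J\}$ (0 = external source/sink). External Poisson arrivals at node $j$ with rates $\lambda_j\ge0$, $\lambda=\sum_j\lambda_j>0$; single servers with infinite waiting room, FCFS, service intensity $\mu_j(n_j)>0$ when $n_j>0$ customers are at node $j$. Extended routing matrix $r=(r(i,j):i,j\in\overline{J}_0)$ is stochastic and irreducible with $r(0,j)=\lambda_j/\lambda$, $r(0,0)=0$. $\eta=(\eta_j:j\in\overline{J}_0)$ is the extended traffic solution: $\eta_0=\lambda$ and $\eta_j=\sum_{i\in\overline{J}_0}\eta_i r(i,j)$ for all $j\in\overline{J}_0$; reversibility of $r$ means $\eta_i r(i,j)=\eta_j r(j,i)$ for all $i,j$. The Jackson network process $\mathbf{X}$ is the Markov chain on $\mathbb{N}_0^{\overline{J}}$ with rates $q(\mathbf{n},\mathbf{n}+\mathbf{e}_i)=\lambda r(0,i)$, $q(\mathbf{n},\mathbf{n}-\mathbf{e}_j+\mathbf{e}_i)=1_{[n_j>0]}\mu_j(n_j)r(j,i)$ ($i\neq j$), $q(\mathbf{n},\mathbf{n}-\mathbf{e}_j)=1_{[n_j>0]}\mu_j(n_j)r(j,0)$; it is assumed ergodic, and $C(j)=\sum_{n\ge0}\prod_{k=1}^n\eta_j/\mu_j(k)<\infty$. $\mathbf{e}_j$ is the $j$-th unit vector. *)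

theory Defs
  imports "HOL-Analysis.Analysis"
begin

section \<open>Generic continuous-time Markov chains given by transition rates\<close>

text \<open>A chain is given by a countable state set S and off-diagonal transition
rates q n m (n \<noteq> m). Only the rates enter the notions below.\<close>

definition qtot :: "'s set \<Rightarrow> ('s \<Rightarrow> 's \<Rightarrow> real) \<Rightarrow> 's \<Rightarrow> real" where
  "qtot S q n = infsum (\<lambda>m. q n m) (S - {n})"

definition stable_rates :: "'s set \<Rightarrow> ('s \<Rightarrow> 's \<Rightarrow> real) \<Rightarrow> bool" where
  "stable_rates S q \<longleftrightarrow> (\<forall>n\<in>S. \<forall>m\<in>S. n \<noteq> m \<longrightarrow> q n m \<ge> 0) \<and>
      (\<forall>n\<in>S. (\<lambda>m. q n m) summable_on (S - {n}))"

definition trans_rel :: "'s set \<Rightarrow> ('s \<Rightarrow> 's \<Rightarrow> real) \<Rightarrow> ('s \<times> 's) set" where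
  "trans_rel S q = {(a, b). a \<in> S \<and> b \<in> S \<and> a \<noteq> b \<and> q a b > 0}"

definition irreducible_chain :: "'s set \<Rightarrow> ('s \<Rightarrow> 's \<Rightarrow> real) \<Rightarrow> bool" where
  "irreducible_chain S q \<longleftrightarrow> (\<forall>n\<in>S. \<forall>m\<in>S. (n, m) \<in> (trans_rel S q)\<^sup>*)"

text \<open>Closed subset of the state space: no positive rate leaves it.\<close>
definition closed_subspace :: "'s set \<Rightarrow> ('s \<Rightarrow> 's \<Rightarrow> real) \<Rightarrow> 's set \<Rightarrow> bool" where
  "closed_subspace S q A \<longleftrightarrow> A \<subseteq> S \<and> (\<forall>n\<in>A. \<forall>m\<in>S - A. q n m = 0)"

text \<open>Stationary distribution: probability on S solving the global balance equations.\<close>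
definition stationary_dist :: "'s set \<Rightarrow> ('s \<Rightarrow> 's \<Rightarrow> real) \<Rightarrow> ('s \<Rightarrow> real) \<Rightarrow> bool" where
  "stationary_dist S q \<pi> \<longleftrightarrow> (\<forall>n\<in>S. \<pi> n \<ge> 0) \<and> (\<pi> has_sum 1) S \<and>
     (\<forall>n\<in>S. (\<lambda>m. \<pi> m * q m n) summable_on (S - {n}) \<and>
            \<pi> n * qtot S q n = infsum (\<lambda>m. \<pi> m * q m n) (S - {n}))"

text \<open>Embedded jump chain and returns to a state, described through finite paths.\<close>
definition jump_prob :: "'s set \<Rightarrow> ('s \<Rightarrow> 's \<Rightarrow> real) \<Rightarrow> 's \<Rightarrow> 's \<Rightarrow> real" where
  "jump_prob S q x y = (if x = y then 0 else q x y / qtot S q x)"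

definition path_prob :: "'s set \<Rightarrow> ('s \<Rightarrow> 's \<Rightarrow> real) \<Rightarrow> 's list \<Rightarrow> real" where
  "path_prob S q xs = (\<Prod>i<length xs - 1. jump_prob S q (xs ! i) (xs ! Suc i))"

text \<open>Expected total holding time along a path (mean sojourn 1/q(x) per visited state).\<close>
definition path_hold :: "'s set \<Rightarrow> ('s \<Rightarrow> 's \<Rightarrow> real) \<Rightarrow> 's list \<Rightarrow> real" where
  "path_hold S q xs = (\<Sum>i<length xs - 1. 1 / qtot S q (xs ! i))"

text \<open>Paths of the jump chain from n that return to n for the first time at the end.\<close>
definition return_paths :: "'s set \<Rightarrow> 's \<Rightarrow> 's list set" where
  "return_paths S n = {xs. 2 \<le> length xs \<and> set xs \<subseteq> S \<and> hd xs = n \<and> last xs = n \<and>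
      (\<forall>i. 0 < i \<and> i < length xs - 1 \<longrightarrow> xs ! i \<noteq> n)}"

text \<open>Positive recurrence (Norris): return to n is certain and the mean return
time E_n[T_n] (starting with the sojourn in n) is finite.\<close>
definition pos_recurrent :: "'s set \<Rightarrow> ('s \<Rightarrow> 's \<Rightarrow> real) \<Rightarrow> 's \<Rightarrow> bool" where
  "pos_recurrent S q n \<longleftrightarrow> qtot S q n > 0 \<and>
     (path_prob S q has_sum 1) (return_paths S n) \<and>
     (\<lambda>xs. path_prob S q xs * path_hold S q xs) summable_on (return_paths S n)"

definition ergodic_chain :: "'s set \<Rightarrow> ('s \<Rightarrow> 's \<Rightarrow> real) \<Rightarrow> bool" where
  "ergodic_chain S q \<longleftrightarrow> stable_rates S q \<and> irreducible_chain S q \<and> (\<forall>n\<in>S. pos_recurrent S q n)"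

section \<open>Jackson networks\<close>

text \<open>Nodes are 1..J, node 0 is the external source/sink. States are functions
nat \<Rightarrow> nat vanishing outside {1..J} (i.e. elements of N_0^J).\<close>

definition states :: "nat \<Rightarrow> (nat \<Rightarrow> nat) set" where
  "states J = {n. \<forall>k. k \<notin> {1..J} \<longrightarrow> n k = 0}"

text \<open>Transition rates of a Jackson-type network with total external arrival rate
lam, routing matrix rr on {0..J}, service intensities mu j k and per-node
service factors s j (s = 1 gives the ordinary Jackson network).\<close>
definition jrate :: "nat \<Rightarrow> real \<Rightarrow> (nat \<Rightarrow> nat \<Rightarrow> real) \<Rightarrow> (nat \<Rightarrow> nat \<Rightarrow> real) \<Rightarrow> (nat \<Rightarrow> real)
    \<Rightarrow> (nat \<Rightarrow> nat) \<Rightarrow> (nat \<Rightarrow> nat) \<Rightarrow> real" where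
  "jrate J lam rr mu s n m =
     (\<Sum>i\<in>{1..J}. if m = n(i := n i + 1) then lam * rr 0 i else 0)
   + (\<Sum>j\<in>{1..J}. \<Sum>i\<in>{1..J} - {j}.
        if 0 < n j \<and> m = n(j := n j - 1, i := n i + 1) then s j * mu j (n j) * rr j i else 0)
   + (\<Sum>j\<in>{1..J}. if 0 < n j \<and> m = n(j := n j - 1) then s j * mu j (n j) * rr j 0 else 0)"

text \<open>Randomized-reflection modification r^(alpha).\<close>
definition rr_mod :: "nat \<Rightarrow> (nat \<Rightarrow> nat \<Rightarrow> real) \<Rightarrow> (nat \<Rightarrow> real) \<Rightarrow> nat \<Rightarrow> nat \<Rightarrow> real" where
  "rr_mod J r \<alpha> i j = (if i \<noteq> j then r i j * \<alpha> j
                       else 1 - (\<Sum>k\<in>{0..J} - {i}. r i k * \<alpha> k))"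

definition alpha_of :: "(nat \<Rightarrow> real) \<Rightarrow> nat \<Rightarrow> real" where
  "alpha_of \<gamma> j = (if j = 0 then 1 else \<gamma> j)"

definition Cnorm :: "(nat \<Rightarrow> real) \<Rightarrow> (nat \<Rightarrow> nat \<Rightarrow> real) \<Rightarrow> nat \<Rightarrow> real" where
  "Cnorm \<eta> mu j = (\<Sum>n. \<Prod>k\<in>{1..n}. \<eta> j / mu j k)"

definition xi :: "nat \<Rightarrow> (nat \<Rightarrow> real) \<Rightarrow> (nat \<Rightarrow> nat \<Rightarrow> real) \<Rightarrow> (nat \<Rightarrow> nat) \<Rightarrow> real" where
  "xi J \<eta> mu n = (\<Prod>j\<in>{1..J}. (\<Prod>k\<in>{1..n j}. \<eta> j / mu j k) / Cnorm \<eta> mu j)"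

text \<open>Distribution xi^(gamma)_phi; phi is a distribution on N_0^B, represented by
functions vanishing outside B.\<close>
definition restrict_to :: "nat set \<Rightarrow> (nat \<Rightarrow> nat) \<Rightarrow> nat \<Rightarrow> nat" where
  "restrict_to B n = (\<lambda>k. if k \<in> B then n k else 0)"

definition xi_phi :: "nat set \<Rightarrow> nat set \<Rightarrow> (nat \<Rightarrow> real) \<Rightarrow> (nat \<Rightarrow> nat \<Rightarrow> real)
    \<Rightarrow> ((nat \<Rightarrow> nat) \<Rightarrow> real) \<Rightarrow> (nat \<Rightarrow> nat) \<Rightarrow> real" where
  "xi_phi W B \<eta> mu \<phi> n =
     (\<Prod>j\<in>W. (\<Prod>k\<in>{1..n j}. \<eta> j / mu j k) / Cnorm \<eta> mu j) * \<phi> (restrict_to B n)"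

end

theory Submission
  imports Defs
begin

text \<open>All networks considered satisfy detailed balance for the product weight: along an edge of the
routing graph the flow is proportional to \<open>\<gamma>\<^sub>j \<eta>\<^sub>j r(j,i) \<gamma>\<^sub>i\<close>, which is symmetric in \<open>i\<close> and \<open>j\<close>.
This gives the stationary distributions. Since rates out of a node may be unbounded, an invariant
probability alone does not yield positive recurrence; recurrence is instead inherited from the
original network by Rayleigh monotonicity. The modified conductances are dominated by the original
ones, and for a reversible chain the probability of returning to \<open>z\<close> is one as soon as some finitely
supported functions with value one at \<open>z\<close> have Dirichlet energy tending to zero; the probabilities
of hitting \<open>z\<close> within \<open>k\<close> steps are such functions for the original network. The mean return time
is then finite because the expected holding times accumulated during an excursion from \<open>z\<close> are
dominated by the total mass of the summable reversible weight.\<close>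

section \<open>Reversible chains of finite range\<close>


text \<open>The sets \<open>F k\<close> are cofinal among the finite subsets of \<open>A\<close>, so
  the unordered sum yields the sequential limit. Conversely, nonnegativity bounds all finite sums by
  that limit, which gives summability. This turns sums over path sets into limits in the number of
  jumps.\<close>

lemma has_sum_iff_incseq_sums_tendsto:
  fixes f :: "'a \<Rightarrow> real"
  assumes nonneg: "\<And>x. x \<in> A \<Longrightarrow> 0 \<le> f x"
    and fin: "\<And>k. finite (F k)" and mono: "incseq F" and A: "A = (\<Union>k. F k)"
  shows "(f has_sum s) A \<longleftrightarrow> (\<lambda>k. sum f (F k)) \<longlonglongrightarrow> s"
proof -
  have cover: "\<exists>k. X \<subseteq> F k" if "finite X" "X \<subseteq> A" for X
    using that
  proof (induction X rule: finite_induct)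
    case (insert x X)
    then obtain k l where "X \<subseteq> F k" "x \<in> F l" using A by auto
    then have "insert x X \<subseteq> F (max k l)"
      using monoD[OF mono, of k "max k l"] monoD[OF mono, of l "max k l"] by auto
    then show ?case by blast
  qed simp
  have lim: "filterlim F (finite_subsets_at_top A) sequentially"
    unfolding filterlim_finite_subsets_at_top
  proof (intro allI impI)
    fix X assume X: "finite X \<and> X \<subseteq> A"
    then obtain k where "X \<subseteq> F k" using cover by blast
    then show "\<forall>\<^sub>F k in sequentially. finite (F k) \<and> X \<subseteq> F k \<and> F k \<subseteq> A"
      unfolding eventually_sequentially using fin A monoD[OF mono] by (intro exI[of _ k]) blast
  qed
  have fwd: "(\<lambda>k. sum f (F k)) \<longlonglongrightarrow> t" if "(f has_sum t) A" for t
    using filterlim_compose[OF that[unfolded has_sum_def] lim] by simp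
  have "f summable_on A" if l: "(\<lambda>k. sum f (F k)) \<longlonglongrightarrow> s"
  proof (rule nonneg_bdd_above_summable_on)
    have inc: "incseq (\<lambda>k. sum f (F k))"
      by (intro monoI sum_mono2 fin monoD[OF mono] nonneg) (auto simp: A)
    show "bdd_above (sum f ` {X. X \<subseteq> A \<and> finite X})"
    proof (rule bdd_aboveI2)
      fix X assume X: "X \<in> {X. X \<subseteq> A \<and> finite X}"
      then obtain k where "X \<subseteq> F k" using cover by blast
      then have "sum f X \<le> sum f (F k)" using nonneg fin A by (intro sum_mono2) auto
      also have "\<dots> \<le> s" using incseq_le[OF inc l] .
      finally show "sum f X \<le> s" .
    qed
  qed (use nonneg in auto)
  then show ?thesis using fwd LIMSEQ_unique has_sum_infsum by blast
qed

section \<open>Locally finite reversible chains: one-step averages, truncated hitting probabilities,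
  balls\<close>

locale reversible_chain =
  fixes S :: "'s set" and q :: "'s \<Rightarrow> 's \<Rightarrow> real" and w :: "'s \<Rightarrow> real"
  assumes q_nonneg: "\<And>x y. x \<in> S \<Longrightarrow> y \<in> S \<Longrightarrow> x \<noteq> y \<Longrightarrow> 0 \<le> q x y"
    and finite_pos_rates: "\<And>x. x \<in> S \<Longrightarrow> finite {y \<in> S - {x}. 0 < q x y}"
    and w_pos: "\<And>x. x \<in> S \<Longrightarrow> 0 < w x"
    and detailed_balance: "\<And>x y. x \<in> S \<Longrightarrow> y \<in> S \<Longrightarrow> x \<noteq> y \<Longrightarrow> w x * q x y = w y * q y x"
    and qtot_pos: "\<And>x. x \<in> S \<Longrightarrow> 0 < qtot S q x"
begin

definition nbr :: "'s \<Rightarrow> 's set" where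
  "nbr x = {y \<in> S - {x}. 0 < q x y}"

text \<open>The transition operator of the embedded jump chain; \<open>flow\<close> below is the
  reversible measure of that chain.\<close>

definition avg :: "('s \<Rightarrow> real) \<Rightarrow> 's \<Rightarrow> real" where
  "avg f x = (\<Sum>y\<in>nbr x. q x y * f y) / qtot S q x"

definition flow :: "'s \<Rightarrow> real" where
  "flow x = w x * qtot S q x"

text \<open>The probability that the jump chain started in \<open>x\<close> visits \<open>z\<close> within \<open>k\<close> steps.\<close>
primrec hit :: "'s \<Rightarrow> nat \<Rightarrow> 's \<Rightarrow> real" where
  "hit z 0 x = (if x = z then 1 else 0)"
| "hit z (Suc k) x = (if x = z then 1 else avg (hit z k) x)"

text \<open>The step out of \<open>z\<close> is extra: this is the probability that the jump chain
  from \<open>z\<close> returns within \<open>k + 1\<close> jumps.\<close>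

definition ret :: "'s \<Rightarrow> nat \<Rightarrow> real" where
  "ret z k = avg (hit z k) z"

primrec nball :: "'s \<Rightarrow> nat \<Rightarrow> 's set" where
  "nball z 0 = {z}"
| "nball z (Suc k) = nball z k \<union> (\<Union>x\<in>nball z k. nbr x)"

text \<open>The Dirichlet form of the conductances \<open>w x * q x y\<close>, cut down to
  \<open>G\<close>. Ordered pairs are summed without a factor 1/2, hence the factor 2 in later
  identities; the diagonal terms vanish whatever \<open>q x x\<close> is.\<close>

definition energy :: "'s set \<Rightarrow> ('s \<Rightarrow> real) \<Rightarrow> ('s \<Rightarrow> real) \<Rightarrow> real" where
  "energy G f g = (\<Sum>x\<in>G. \<Sum>y\<in>G. w x * q x y * (f x - f y) * (g x - g y))"

lemma finite_nbr: "x \<in> S \<Longrightarrow> finite (nbr x)"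
  unfolding nbr_def by (rule finite_pos_rates)

lemma nbr_subset: "nbr x \<subseteq> S" and not_in_nbr_self: "x \<notin> nbr x"
  by (auto simp: nbr_def)

lemma nbrD: "y \<in> nbr x \<Longrightarrow> y \<in> S" "y \<in> nbr x \<Longrightarrow> 0 < q x y"
  by (auto simp: nbr_def)

lemma nbr_sym: "x \<in> S \<Longrightarrow> y \<in> nbr x \<Longrightarrow> x \<in> nbr y"
  using detailed_balance[of x y] w_pos[of x] w_pos[of y]
  by (auto simp: nbr_def) (metis mult_pos_pos zero_less_mult_pos)

lemma rate_eq_0: "x \<in> S \<Longrightarrow> y \<in> S \<Longrightarrow> y \<noteq> x \<Longrightarrow> y \<notin> nbr x \<Longrightarrow> q x y = 0"
  using q_nonneg[of x y] by (auto simp: nbr_def)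

lemma qtot_eq: "x \<in> S \<Longrightarrow> qtot S q x = (\<Sum>y\<in>nbr x. q x y)"
  unfolding qtot_def
  by (subst infsum_cong_neutral[where T = "nbr x" and g = "q x"])
     (use rate_eq_0[of x] finite_nbr[of x] in \<open>auto simp: nbr_def\<close>)

lemma flow_pos: "x \<in> S \<Longrightarrow> 0 < flow x"
  by (simp add: flow_def w_pos qtot_pos)

lemma avg_const: "x \<in> S \<Longrightarrow> avg (\<lambda>_. c) x = c"
  using qtot_pos[of x] by (simp add: avg_def sum_distrib_right[symmetric] qtot_eq[symmetric])

lemma avg_mono: "x \<in> S \<Longrightarrow> (\<And>y. y \<in> nbr x \<Longrightarrow> f y \<le> g y) \<Longrightarrow> avg f x \<le> avg g x"
  unfolding avg_def using qtot_pos[of x] nbrD(2)[of _ x]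
  by (intro divide_right_mono sum_mono mult_left_mono) (auto intro: less_imp_le)

lemma avg_add: "avg (\<lambda>y. f y + g y) x = avg f x + avg g x"
  by (simp add: avg_def sum.distrib distrib_left add_divide_distrib)

lemma avg_cong: "(\<And>y. y \<in> nbr x \<Longrightarrow> f y = g y) \<Longrightarrow> avg f x = avg g x"
  by (simp add: avg_def)

lemma hit_self [simp]: "hit z k z = 1"
  by (cases k) auto

lemma hit_bounds: "x \<in> S \<Longrightarrow> 0 \<le> hit z k x \<and> hit z k x \<le> 1"
proof (induction k arbitrary: x)
  case (Suc k)
  then show ?case
    using avg_mono[of x "\<lambda>_. 0" "hit z k"] avg_mono[of x "hit z k" "\<lambda>_. 1"] nbrD(1)[of _ x]
    by (auto simp: avg_const)
qed simp

lemma hit_Suc_ge: "x \<in> S \<Longrightarrow> hit z k x \<le> hit z (Suc k) x"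
proof (induction k arbitrary: x)
  case 0
  then show ?case using hit_bounds[of x z "Suc 0"] by (auto simp del: hit.simps(2))
next
  case (Suc k)
  then have "avg (hit z k) x \<le> avg (hit z (Suc k)) x"
    by (intro avg_mono Suc.IH) (auto dest: nbrD)
  then show ?case using Suc by (cases "x = z") simp_all
qed

lemma ret_mono: "z \<in> S \<Longrightarrow> incseq (ret z)"
  unfolding ret_def by (intro incseq_SucI avg_mono hit_Suc_ge) (auto dest: nbrD)

lemma ret_bounds: "z \<in> S \<Longrightarrow> 0 \<le> ret z k \<and> ret z k \<le> 1"
  unfolding ret_def
  using avg_mono[of z "\<lambda>_. 0" "hit z k"] avg_mono[of z "hit z k" "\<lambda>_. 1"] hit_bounds nbrD(1)[of _ z]
  by (auto simp: avg_const)

lemma nball_subset: "z \<in> S \<Longrightarrow> nball z k \<subseteq> S"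
  using nbr_subset by (induction k) auto

lemma finite_nball: "z \<in> S \<Longrightarrow> finite (nball z k)"
  using nball_subset finite_nbr by (induction k) (auto simp: subset_iff)

lemma center_in_nball [simp]: "z \<in> nball z k"
  by (induction k) auto

lemma nball_mono: "k \<le> l \<Longrightarrow> nball z k \<subseteq> nball z l"
  by (rule lift_Suc_mono_le[of "nball z"]) auto

lemma nbr_nball: "x \<in> nball z k \<Longrightarrow> nbr x \<subseteq> nball z (Suc k)"
  by auto

text \<open>Hitting probabilities follow paths towards \<open>z\<close>, whereas balls grow outwards
  from \<open>z\<close>; \<open>nbr_sym\<close> reconciles the two directions. Hence
  \<open>hit z k\<close> has finite support and may serve as a test function.\<close>

lemma hit_support: "x \<in> S \<Longrightarrow> hit z k x \<noteq> 0 \<Longrightarrow> x \<in> nball z k"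
proof (induction k arbitrary: x)
  case (Suc k)
  show ?case
  proof (cases "x = z")
    case False
    then have "(\<Sum>y\<in>nbr x. q x y * hit z k y) \<noteq> 0" using Suc.prems by (auto simp: avg_def)
    then obtain y where y: "y \<in> nbr x" "hit z k y \<noteq> 0"
      by (metis (mono_tags, lifting) mult_zero_right sum.neutral)
    then have "y \<in> nball z k" using Suc.IH nbrD by blast
    moreover have "x \<in> nbr y" using y nbr_sym Suc.prems by blast
    ultimately show ?thesis by auto
  qed simp
qed (auto split: if_splits)

section \<open>Discrete Laplacian, Green's formula and Dirichlet energy\<close>

lemma flow_diff_avg:
  assumes "x \<in> S"
  shows "flow x * (f x - avg f x) = (\<Sum>y\<in>nbr x. w x * q x y * (f x - f y))"
proof -
  have "flow x * avg f x = (\<Sum>y\<in>nbr x. w x * q x y * f y)"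
    using qtot_pos[OF assms]
    by (simp add: flow_def avg_def sum_distrib_left[symmetric] mult.assoc)
  moreover have "flow x * f x = (\<Sum>y\<in>nbr x. w x * q x y * f x)"
    by (simp add: flow_def qtot_eq[OF assms] sum_distrib_left sum_distrib_right)
  ultimately show ?thesis by (simp add: right_diff_distrib sum_subtractf)
qed

lemma conductance_sym: "x \<in> S \<Longrightarrow> y \<in> S \<Longrightarrow> w x * q x y = w y * q y x"
  using detailed_balance by (cases "x = y") auto

lemma energy_commute: "energy G f g = energy G g f"
  by (simp add: energy_def mult_ac)

text \<open>Summation by parts: by symmetry of the conductances, the half of the double sum with
  \<open>f y\<close> becomes the half with \<open>f x\<close> after exchanging \<open>x\<close> and
  \<open>y\<close>.\<close>

lemma energy_eq:
  assumes G: "finite G" "G \<subseteq> S"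
  shows "energy G f g = 2 * (\<Sum>x\<in>G. f x * (\<Sum>y\<in>G. w x * q x y * (g x - g y)))"
proof -
  let ?h = "\<lambda>x y. w x * q x y * f x * (g x - g y)"
  have "energy G f g = (\<Sum>x\<in>G. \<Sum>y\<in>G. ?h x y) + (\<Sum>x\<in>G. \<Sum>y\<in>G. ?h y x)"
    unfolding energy_def sum.distrib[symmetric]
  proof (intro sum.cong refl)
    fix x y assume "x \<in> G" "y \<in> G"
    then have "w y * q y x = w x * q x y" using conductance_sym G by auto
    then show "w x * q x y * (f x - f y) * (g x - g y) = ?h x y + ?h y x"
      by (simp add: algebra_simps)
  qed
  also have "(\<Sum>x\<in>G. \<Sum>y\<in>G. ?h y x) = (\<Sum>x\<in>G. \<Sum>y\<in>G. ?h x y)"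
    by (rule sum.swap)
  finally show ?thesis by (simp add: sum_distrib_left mult_ac)
qed

text \<open>\<open>f\<close> vanishes at every state of \<open>G\<close> that has a neighbour
  outside \<open>G\<close>. So no edge leaving \<open>G\<close> carries a difference of
  \<open>f\<close>, and where \<open>f\<close> is nonzero the sum over \<open>G\<close> sees all
  neighbours: truncation to \<open>G\<close> loses nothing, for arbitrary \<open>g\<close>.\<close>

lemma green:
  assumes G: "finite G" "G \<subseteq> S" and supp: "\<And>x. x \<in> S \<Longrightarrow> f x \<noteq> 0 \<Longrightarrow> x \<in> G \<and> nbr x \<subseteq> G"
  shows "energy G f g = 2 * (\<Sum>x\<in>G. flow x * f x * (g x - avg g x))"
    and "energy G f g = 2 * (\<Sum>x\<in>G. flow x * g x * (f x - avg f x))"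
proof -
  have inner: "(\<Sum>y\<in>G. w x * q x y * (h x - h y)) = flow x * (h x - avg h x)"
    if "x \<in> G" "\<And>y. y \<in> nbr x - G \<Longrightarrow> h x = h y" for x h
  proof -
    have x: "x \<in> S" using that G by auto
    show ?thesis
      unfolding flow_diff_avg[OF x]
    proof (rule sum.mono_neutral_cong)
      show "finite (nbr x)" "finite G" using finite_nbr x G by auto
    qed (use that G x rate_eq_0[OF x] in auto)
  qed
  show "energy G f g = 2 * (\<Sum>x\<in>G. flow x * f x * (g x - avg g x))"
    unfolding energy_eq[OF G]
  proof (intro arg_cong[where f = "(*) 2"] sum.cong refl)
    fix x assume x: "x \<in> G"
    show "f x * (\<Sum>y\<in>G. w x * q x y * (g x - g y)) = flow x * f x * (g x - avg g x)"
    proof (cases "f x = 0")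
      case False
      then have "nbr x - G = {}" using supp[of x] x G by auto
      then have "(\<Sum>y\<in>G. w x * q x y * (g x - g y)) = flow x * (g x - avg g x)"
        using inner[OF x, of g] by blast
      then show ?thesis by simp
    qed simp
  qed
  show "energy G f g = 2 * (\<Sum>x\<in>G. flow x * g x * (f x - avg f x))"
  proof (subst energy_commute, subst energy_eq[OF G], intro arg_cong[where f = "(*) 2"] sum.cong refl)
    fix x assume x: "x \<in> G"
    have "f x = f y" if "y \<in> nbr x - G" for y
      using supp[of x] supp[of y] that x G nbrD(1) by (metis DiffD1 DiffD2 subsetD)
    then have "(\<Sum>y\<in>G. w x * q x y * (f x - f y)) = flow x * (f x - avg f x)"
      using inner[OF x, of f] by blast
    then show "g x * (\<Sum>y\<in>G. w x * q x y * (f x - f y)) = flow x * g x * (f x - avg f x)"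
      by simp
  qed
qed

text \<open>Off \<open>z\<close> the function \<open>hit z k\<close> is subharmonic, since its
  average is \<open>hit z (Suc k)\<close>, which is at least as large. In Green's formula with
  \<open>f = g\<close> only the term at \<open>z\<close> can therefore be positive.\<close>

lemma energy_hit_le:
  assumes z: "z \<in> S" and G: "finite G" "nball z (Suc k) \<subseteq> G" "G \<subseteq> S"
  shows "energy G (hit z k) (hit z k) \<le> 2 * flow z * (1 - ret z k)"
proof -
  have zG: "z \<in> G" using G center_in_nball by blast
  have supp: "x \<in> G \<and> nbr x \<subseteq> G" if "x \<in> S" "hit z k x \<noteq> 0" for x
    using hit_support[OF that] nbr_nball[of x z k] nball_mono[of k "Suc k" z] G by auto
  have "energy G (hit z k) (hit z k) = 2 * (\<Sum>x\<in>G. flow x * hit z k x * (hit z k x - avg (hit z k) x))"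
    using green(1)[OF G(1,3) supp] .
  also have "(\<Sum>x\<in>G. flow x * hit z k x * (hit z k x - avg (hit z k) x))
      = flow z * (1 - ret z k) + (\<Sum>x\<in>G - {z}. flow x * hit z k x * (hit z k x - hit z (Suc k) x))"
    by (subst sum.remove[OF G(1) zG]) (simp add: ret_def)
  also have "(\<Sum>x\<in>G - {z}. flow x * hit z k x * (hit z k x - hit z (Suc k) x)) \<le> 0"
  proof (intro sum_nonpos mult_nonneg_nonpos mult_nonneg_nonneg)
    fix x assume "x \<in> G - {z}"
    then have x: "x \<in> S" using G by auto
    show "0 \<le> flow x" using flow_pos[OF x] by simp
    show "0 \<le> hit z k x" using hit_bounds[OF x] by simp
    show "hit z k x - hit z (Suc k) x \<le> 0" using hit_Suc_ge[OF x, of z k] by simp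
  qed
  finally show ?thesis by simp
qed

section \<open>Limits of the truncated probabilities and expected holding times\<close>

lemma hit_convergent: "x \<in> S \<Longrightarrow> convergent (\<lambda>k. hit z k x)"
  using hit_bounds hit_Suc_ge
  by (intro Bseq_monoseq_convergent BseqI'[of _ 1] incseq_imp_monoseq incseq_SucI) auto

lemma ret_convergent: "z \<in> S \<Longrightarrow> convergent (ret z)"
  using ret_bounds
  by (intro Bseq_monoseq_convergent BseqI'[of _ 1] incseq_imp_monoseq ret_mono) auto

text \<open>The expected holding time before \<open>z\<close> is visited or \<open>k\<close> jumps have been made.\<close>
primrec hold :: "'s \<Rightarrow> nat \<Rightarrow> 's \<Rightarrow> real" where
  "hold z 0 x = 0"
| "hold z (Suc k) x = (if x = z then 0 else 1 / qtot S q x + avg (hold z k) x)"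

lemma hold_self [simp]: "hold z k z = 0"
  by (cases k) auto

text \<open>Green's formula for \<open>hit\<close> against \<open>hold\<close>; the right-hand side telescopes when \<open>j + k\<close> is fixed.\<close>
lemma hold_hit_exchange:
  assumes z: "z \<in> S" and G: "finite G" "nball z (Suc j) \<subseteq> G" "G \<subseteq> S"
  shows "flow z * avg (hold z k) z - (\<Sum>x\<in>G - {z}. w x * hit z j x)
    = (\<Sum>x\<in>G - {z}. flow x * hit z (Suc j) x * hold z k x)
      - (\<Sum>x\<in>G - {z}. flow x * hit z j x * hold z (Suc k) x)"
proof -
  have zG: "z \<in> G" using G center_in_nball by blast
  have supp: "x \<in> G \<and> nbr x \<subseteq> G" if "x \<in> S" "hit z j x \<noteq> 0" for x
    using hit_support[OF that] nbr_nball[of x z j] nball_mono[of j "Suc j" z] G by auto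
  have "(\<Sum>x\<in>G. flow x * hit z j x * (hold z k x - avg (hold z k) x))
      = (\<Sum>x\<in>G. flow x * hold z k x * (hit z j x - avg (hit z j) x))"
    using green[OF G(1,3) supp, where g = "hold z k"] by simp
  then have "- flow z * avg (hold z k) z
      + (\<Sum>x\<in>G - {z}. flow x * hit z j x * (hold z k x - avg (hold z k) x))
      = (\<Sum>x\<in>G - {z}. flow x * hold z k x * (hit z j x - hit z (Suc j) x))"
    by (simp add: sum.remove[OF G(1) zG])
  \<comment> \<open>Off \<open>z\<close> the recursion for \<open>hold\<close> contributes
    \<open>1 / qtot S q x\<close>, and \<open>flow x / qtot S q x = w x\<close> produces the weight
    term.\<close>
  moreover have "(\<Sum>x\<in>G - {z}. flow x * hit z j x * (hold z k x - avg (hold z k) x))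
      = (\<Sum>x\<in>G - {z}. flow x * hit z j x * (hold z k x - hold z (Suc k) x) + w x * hit z j x)"
  proof (rule sum.cong)
    fix x assume "x \<in> G - {z}"
    then have "x \<in> S" "x \<noteq> z" using G by auto
    then show "flow x * hit z j x * (hold z k x - avg (hold z k) x)
      = flow x * hit z j x * (hold z k x - hold z (Suc k) x) + w x * hit z j x"
      using qtot_pos[of x] by (simp add: flow_def field_simps)
  qed simp
  ultimately show ?thesis
    by (simp add: sum.distrib sum_subtractf right_diff_distrib mult_ac del: hit.simps hold.simps)
qed

text \<open>By time reversal, the mean time spent in \<open>x\<close> during an excursion from
  \<open>z\<close> is \<open>w x / flow z\<close> times the chance of hitting \<open>z\<close> from
  \<open>x\<close>; here both are truncated at \<open>k\<close>.\<close>

lemma flow_avg_hold: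
  assumes z: "z \<in> S"
  shows "flow z * avg (hold z k) z = (\<Sum>x\<in>nball z (Suc k) - {z}. w x * hit z k x)"
proof -
  define G where "G = nball z (Suc k)"
  define b where "b i = flow z * avg (hold z i) z" for i
  define e where "e i = (\<Sum>x\<in>G - {z}. w x * hit z i x)" for i
  define d where "d i j = (\<Sum>x\<in>G - {z}. flow x * hit z i x * hold z j x)" for i j
  \<comment> \<open>One set \<open>G\<close> serves all \<open>i \<le> k\<close>, since it contains
    every smaller ball, so that \<open>d\<close> has a fixed domain and can telescope.\<close>
  have step: "b j - e i = d (Suc i) j - d i (Suc j)" if "i \<le> k" for i j
    unfolding b_def e_def d_def G_def
    using hold_hit_exchange[OF z finite_nball[OF z] nball_mono nball_subset[OF z], of i "Suc k" j] that
    by simp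
  \<comment> \<open>Along the antidiagonal \<open>i + j = l\<close> the right-hand sides telescope.
    Both end terms vanish: \<open>hold z 0\<close> is zero, and \<open>hit z 0\<close> is zero off
    \<open>z\<close>.\<close>
  have sums: "(\<Sum>i\<le>l. b i) = (\<Sum>i\<le>l. e i)" if "l \<le> k" for l
  proof -
    have "(\<Sum>i\<le>l. b (l - i)) - (\<Sum>i\<le>l. e i) = (\<Sum>i\<le>l. b (l - i) - e i)"
      by (simp add: sum_subtractf)
    also have "\<dots> = (\<Sum>i<Suc l. d (Suc i) (Suc l - Suc i) - d i (Suc l - i))"
      using that by (intro sum.cong) (auto simp: step Suc_diff_le lessThan_Suc_atMost)
    also have "\<dots> = d (Suc l) 0 - d 0 (Suc l)"
      using sum_lessThan_telescope[of "\<lambda>i. d i (Suc l - i)" "Suc l"] by simp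
    also have "\<dots> = 0" by (auto simp: d_def intro!: sum.neutral)
    finally show ?thesis by (simp add: sum.nat_diff_reindex lessThan_Suc_atMost[symmetric]
          sum.nat_diff_reindex[of b "Suc l", simplified])
  qed
  have "b k = e k"
    using sums[of k] sums[of "k - 1"] by (cases k) auto
  then show ?thesis by (simp add: b_def e_def G_def)
qed

text \<open>Bounding \<open>hit\<close> by 1 in the time-reversed expression leaves a partial sum of
  \<open>w\<close>, so the bound does not depend on \<open>k\<close>.\<close>

lemma avg_hold_le:
  assumes z: "z \<in> S" and w: "w summable_on S"
  shows "avg (hold z k) z \<le> infsum w S / flow z"
proof -
  have "(\<Sum>x\<in>nball z (Suc k) - {z}. w x * hit z k x) \<le> (\<Sum>x\<in>nball z (Suc k) - {z}. w x)"
  proof (rule sum_mono)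
    fix x assume "x \<in> nball z (Suc k) - {z}"
    then have x: "x \<in> S" using nball_subset[OF z, of "Suc k"] by blast
    then show "w x * hit z k x \<le> w x"
      using w_pos[OF x] hit_bounds[OF x, of z k] by (simp add: mult_left_le)
  qed
  also have "\<dots> \<le> infsum w S"
    using finite_nball[OF z, of "Suc k"] nball_subset[OF z, of "Suc k"] w_pos
    by (intro finite_sum_le_infsum[OF w]) (auto intro: less_imp_le)
  finally show ?thesis
    using flow_pos[OF z] by (simp add: flow_avg_hold[OF z] pos_le_divide_eq mult.commute)
qed

section \<open>Path sums for hitting and return\<close>

primrec hit_paths :: "'s \<Rightarrow> nat \<Rightarrow> 's \<Rightarrow> 's list set" where
  "hit_paths z 0 x = (if x = z then {[z]} else {})"
| "hit_paths z (Suc k) x = (if x = z then {[z]} else (\<Union>y\<in>nbr x. (#) x ` hit_paths z k y))"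

text \<open>These paths have at most \<open>k + 1\<close> jumps. Only positive rates are followed,
  so the sets are finite, and the return paths missed by their union have probability zero.\<close>

definition ret_paths :: "'s \<Rightarrow> nat \<Rightarrow> 's list set" where
  "ret_paths z k = (\<Union>y\<in>nbr z. (#) z ` hit_paths z k y)"

lemma finite_hit_paths: "x \<in> S \<Longrightarrow> finite (hit_paths z k x)"
  by (induction k arbitrary: x) (auto intro: finite_nbr dest: nbrD)

lemma hit_paths_hd: "xs \<in> hit_paths z k x \<Longrightarrow> xs \<noteq> [] \<and> hd xs = x"
  by (cases k) (auto split: if_splits)

lemma hit_paths_Suc: "hit_paths z k x \<subseteq> hit_paths z (Suc k) x"
proof (induction k arbitrary: x)
  case (Suc k)
  show ?case
  proof (cases "x = z")
    case False
    then show ?thesis using Suc.IH by (simp del: hit_paths.simps(2) add: hit_paths.simps(2)[of _ _ x]) blast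
  qed simp
qed auto

lemma path_prob_Cons:
  "xs \<noteq> [] \<Longrightarrow> path_prob S q (x # xs) = jump_prob S q x (hd xs) * path_prob S q xs"
  by (cases xs) (simp_all add: path_prob_def prod.lessThan_Suc_shift del: prod.lessThan_Suc)

lemma path_hold_Cons:
  "xs \<noteq> [] \<Longrightarrow> path_hold S q (x # xs) = 1 / qtot S q x + path_hold S q xs"
  by (cases xs) (simp_all add: path_hold_def sum.lessThan_Suc_shift del: sum.lessThan_Suc)

lemma path_single [simp]: "path_prob S q [x] = 1" "path_hold S q [x] = 0"
  by (simp_all add: path_prob_def path_hold_def)

text \<open>Conditioning on the first jump: the sets for different \<open>y\<close> are disjoint
  because the second entry of a path determines \<open>y\<close>. General \<open>f\<close> and
  \<open>g\<close> cover both probabilities and weighted holding times.\<close>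

lemma sum_over_first_step:
  assumes x: "x \<in> S"
    and f: "\<And>xs. xs \<noteq> [] \<Longrightarrow> f (x # xs) = jump_prob S q x (hd xs) * g xs"
  shows "(\<Sum>xs\<in>(\<Union>y\<in>nbr x. (#) x ` hit_paths z k y). f xs) = avg (\<lambda>y. \<Sum>xs\<in>hit_paths z k y. g xs) x"
proof -
  have "(\<Sum>xs\<in>(\<Union>y\<in>nbr x. (#) x ` hit_paths z k y). f xs)
      = (\<Sum>y\<in>nbr x. \<Sum>xs\<in>(#) x ` hit_paths z k y. f xs)"
    using finite_nbr[OF x] finite_hit_paths nbrD(1) hit_paths_hd
    by (intro sum.UNION_disjoint) (auto, blast+)
  also have "\<dots> = (\<Sum>y\<in>nbr x. q x y / qtot S q x * (\<Sum>xs\<in>hit_paths z k y. g xs))"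
  proof (rule sum.cong)
    fix y assume y: "y \<in> nbr x"
    have "(\<Sum>xs\<in>(#) x ` hit_paths z k y. f xs) = (\<Sum>xs\<in>hit_paths z k y. f (x # xs))"
      by (subst sum.reindex) auto
    also have "\<dots> = (\<Sum>xs\<in>hit_paths z k y. q x y / qtot S q x * g xs)"
      using hit_paths_hd not_in_nbr_self[of x] y
      by (intro sum.cong refl) (auto simp: f jump_prob_def dest!: hit_paths_hd)
    finally show "(\<Sum>xs\<in>(#) x ` hit_paths z k y. f xs)
        = q x y / qtot S q x * (\<Sum>xs\<in>hit_paths z k y. g xs)"
      by (simp add: sum_distrib_left)
  qed simp
  finally show ?thesis by (simp add: avg_def sum_divide_distrib)
qed

lemma sum_path_prob_hit_paths: "x \<in> S \<Longrightarrow> sum (path_prob S q) (hit_paths z k x) = hit z k x"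
proof (induction k arbitrary: x)
  case (Suc k)
  then show ?case
    by (auto simp: sum_over_first_step[OF _ path_prob_Cons] dest: nbrD intro!: avg_cong)
qed simp

lemma sum_path_prob_ret_paths: "z \<in> S \<Longrightarrow> sum (path_prob S q) (ret_paths z k) = ret z k"
  unfolding ret_paths_def ret_def
  by (auto simp: sum_over_first_step[OF _ path_prob_Cons] sum_path_prob_hit_paths
      dest: nbrD intro!: avg_cong)

lemma sum_path_hold_first_step:
  assumes x: "x \<in> S"
  shows "(\<Sum>xs\<in>(\<Union>y\<in>nbr x. (#) x ` hit_paths z k y). path_prob S q xs * path_hold S q xs)
    = avg (hit z k) x / qtot S q x + avg (\<lambda>y. \<Sum>xs\<in>hit_paths z k y. path_prob S q xs * path_hold S q xs) x"
proof -
  have "(\<Sum>xs\<in>(\<Union>y\<in>nbr x. (#) x ` hit_paths z k y). path_prob S q xs * path_hold S q xs)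
    = avg (\<lambda>y. \<Sum>xs\<in>hit_paths z k y. path_prob S q xs / qtot S q x + path_prob S q xs * path_hold S q xs) x"
    by (intro sum_over_first_step[OF x]) (simp add: path_prob_Cons path_hold_Cons algebra_simps)
  also have "\<dots> = avg (\<lambda>y. hit z k y / qtot S q x
      + (\<Sum>xs\<in>hit_paths z k y. path_prob S q xs * path_hold S q xs)) x"
    by (rule avg_cong) (simp add: sum.distrib sum_divide_distrib[symmetric] sum_path_prob_hit_paths nbrD)
  finally show ?thesis
    by (simp add: avg_add) (simp add: avg_def sum_divide_distrib)
qed

text \<open>Only an inequality: the path sum counts holding times on trajectories that reach
  \<open>z\<close> in time, whereas \<open>hold\<close> also counts the others.\<close>

lemma sum_path_hold_hit_paths:
  "x \<in> S \<Longrightarrow> (\<Sum>xs\<in>hit_paths z k x. path_prob S q xs * path_hold S q xs) \<le> hold z k x"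
proof (induction k arbitrary: x)
  case (Suc k)
  show ?case
  proof (cases "x = z")
    case False
    have "avg (hit z k) x / qtot S q x \<le> 1 / qtot S q x"
      using hit_bounds[OF Suc.prems, of z "Suc k"] qtot_pos[OF Suc.prems] False
      by (intro divide_right_mono) auto
    moreover have "avg (\<lambda>y. \<Sum>xs\<in>hit_paths z k y. path_prob S q xs * path_hold S q xs) x \<le> avg (hold z k) x"
      by (intro avg_mono Suc nbrD)
    ultimately show ?thesis using False Suc.prems by (simp add: sum_path_hold_first_step)
  qed simp
qed simp

lemma sum_path_hold_ret_paths:
  assumes z: "z \<in> S" and w: "w summable_on S"
  shows "(\<Sum>xs\<in>ret_paths z k. path_prob S q xs * path_hold S q xs) \<le> 1 / qtot S q z + infsum w S / flow z"
proof -
  have "avg (hit z k) z / qtot S q z \<le> 1 / qtot S q z"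
    using ret_bounds[OF z, of k] qtot_pos[OF z] by (intro divide_right_mono) (auto simp: ret_def)
  moreover have "avg (\<lambda>y. \<Sum>xs\<in>hit_paths z k y. path_prob S q xs * path_hold S q xs) z \<le> avg (hold z k) z"
    by (intro avg_mono sum_path_hold_hit_paths z nbrD)
  ultimately show ?thesis
    unfolding ret_paths_def sum_path_hold_first_step[OF z] using avg_hold_le[OF z w, of k] by linarith
qed

text \<open>Passes from the recursive finite sets to a description free of \<open>k\<close>, by
  induction on \<open>k\<close> one way and on the path the other. Nonzero probability encodes that
  every jump has a positive rate.\<close>

lemma hit_paths_iff:
  "(\<exists>k. xs \<in> hit_paths z k x) \<longleftrightarrow> xs \<noteq> [] \<and> hd xs = x \<and> last xs = z \<and> z \<notin> set (butlast xs) \<and>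
    set xs \<subseteq> S \<and> path_prob S q xs \<noteq> 0" if "x \<in> S"
proof
  have "xs \<noteq> [] \<and> hd xs = x \<and> last xs = z \<and> z \<notin> set (butlast xs) \<and> set xs \<subseteq> S \<and> path_prob S q xs \<noteq> 0"
    if "x \<in> S" "xs \<in> hit_paths z k x" for k
    using that
  proof (induction k arbitrary: x xs)
    case (Suc k)
    show ?case
    proof (cases "x = z")
      case False
      then obtain y ys where y: "y \<in> nbr x" "ys \<in> hit_paths z k y" "xs = x # ys"
        using Suc.prems by auto
      then have "jump_prob S q x y \<noteq> 0"
        using qtot_pos[OF Suc.prems(1)] by (auto simp: jump_prob_def nbr_def)
      then show ?thesis
        using y Suc.IH[OF nbrD(1)[OF y(1)] y(2)] Suc.prems(1) False by (auto simp: path_prob_Cons)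
    qed (use Suc.prems in auto)
  qed (auto split: if_splits)
  then show "xs \<noteq> [] \<and> hd xs = x \<and> last xs = z \<and> z \<notin> set (butlast xs) \<and> set xs \<subseteq> S \<and> path_prob S q xs \<noteq> 0"
    if "\<exists>k. xs \<in> hit_paths z k x" using that \<open>x \<in> S\<close> by blast
next
  assume "xs \<noteq> [] \<and> hd xs = x \<and> last xs = z \<and> z \<notin> set (butlast xs) \<and> set xs \<subseteq> S \<and> path_prob S q xs \<noteq> 0"
  then show "\<exists>k. xs \<in> hit_paths z k x"
  proof (induction xs arbitrary: x)
    case (Cons a ys)
    show ?case
    proof (cases ys)
      case Nil
      then show ?thesis using Cons.prems by (intro exI[of _ 0]) auto
    next
      case (Cons y zs)
      then have *: "path_prob S q ys \<noteq> 0" "jump_prob S q x y \<noteq> 0" "x \<noteq> z" "x \<in> S" "y \<in> S"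
        using Cons.prems by (auto simp: path_prob_Cons)
      obtain k where k: "ys \<in> hit_paths z k y"
        using Cons.IH[of y] Cons.prems * Cons by auto
      have "y \<in> nbr x" using * rate_eq_0[of x y] by (auto simp: jump_prob_def split: if_splits)
      then have "a # ys \<in> hit_paths z (Suc k) x" using k * Cons.prems by auto
      then show ?thesis by blast
    qed
  qed simp
qed

lemma return_paths_eq:
  "return_paths S z = {z # xs |xs. z \<in> S \<and> xs \<noteq> [] \<and> last xs = z \<and> z \<notin> set (butlast xs) \<and> set xs \<subseteq> S}"
    (is "_ = ?R")
proof -
  have *: "(\<forall>i. 0 < i \<and> i < length (a # ys) - 1 \<longrightarrow> (a # ys) ! i \<noteq> z) \<longleftrightarrow> z \<notin> set (butlast ys)"
    if "ys \<noteq> []" for a ys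
  proof -
    have "(\<forall>i. 0 < i \<and> i < length (a # ys) - 1 \<longrightarrow> (a # ys) ! i \<noteq> z)
        \<longleftrightarrow> (\<forall>i<length ys - 1. ys ! i \<noteq> z)"
    proof (intro iffI allI impI)
      fix i assume "\<forall>i. 0 < i \<and> i < length (a # ys) - 1 \<longrightarrow> (a # ys) ! i \<noteq> z" "i < length ys - 1"
      then show "ys ! i \<noteq> z" by (auto dest: spec[of _ "Suc i"])
    next
      fix i assume "\<forall>i<length ys - 1. ys ! i \<noteq> z" "0 < i \<and> i < length (a # ys) - 1"
      then show "(a # ys) ! i \<noteq> z" by (cases i) auto
    qed
    also have "\<dots> \<longleftrightarrow> z \<notin> set (butlast ys)"
      by (auto simp: in_set_conv_nth nth_butlast)
    finally show ?thesis .
  qed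
  have "xs \<in> return_paths S z \<longleftrightarrow> xs \<in> ?R" for xs
  proof (cases xs)
    case (Cons a ys)
    then show ?thesis
      using *[of ys a] by (cases "ys = []") (auto simp: return_paths_def Suc_le_eq)
  qed (simp add: return_paths_def)
  then show ?thesis by blast
qed

lemma Union_ret_paths:
  assumes z: "z \<in> S"
  shows "(\<Union>k. ret_paths z k) = {xs \<in> return_paths S z. path_prob S q xs \<noteq> 0}"
proof (intro equalityI subsetI)
  fix xs assume "xs \<in> (\<Union>k. ret_paths z k)"
  then obtain k y ys where y: "y \<in> nbr z" "ys \<in> hit_paths z k y" "xs = z # ys"
    unfolding ret_paths_def by auto
  moreover have "jump_prob S q z y \<noteq> 0"
    using qtot_pos[OF z] y by (auto simp: jump_prob_def nbr_def)
  moreover have "ys \<noteq> [] \<and> hd ys = y \<and> last ys = z \<and> z \<notin> set (butlast ys) \<and> set ys \<subseteq> S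
      \<and> path_prob S q ys \<noteq> 0"
    using hit_paths_iff[OF nbrD(1)[OF y(1)], of ys z] y by blast
  ultimately show "xs \<in> {xs \<in> return_paths S z. path_prob S q xs \<noteq> 0}"
    using z by (auto simp: return_paths_eq path_prob_Cons)
next
  fix xs assume "xs \<in> {xs \<in> return_paths S z. path_prob S q xs \<noteq> 0}"
  then obtain ys where ys: "xs = z # ys" "ys \<noteq> []" "last ys = z" "z \<notin> set (butlast ys)" "set ys \<subseteq> S"
    "path_prob S q xs \<noteq> 0" by (auto simp: return_paths_eq)
  then have *: "path_prob S q ys \<noteq> 0" "jump_prob S q z (hd ys) \<noteq> 0" "hd ys \<in> S"
    by (auto simp: path_prob_Cons)
  then have "hd ys \<in> nbr z" using rate_eq_0[of z "hd ys"] z by (auto simp: jump_prob_def split: if_splits)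
  moreover obtain k where "ys \<in> hit_paths z k (hd ys)"
    using hit_paths_iff[OF *(3), of ys z] ys * by blast
  ultimately show "xs \<in> (\<Union>k. ret_paths z k)" unfolding ret_paths_def using ys by auto
qed

lemma finite_ret_paths: "z \<in> S \<Longrightarrow> finite (ret_paths z k)"
  unfolding ret_paths_def by (auto intro: finite_nbr finite_hit_paths dest: nbrD)

lemma incseq_ret_paths: "incseq (ret_paths z)"
  unfolding ret_paths_def by (intro incseq_SucI UN_mono image_mono hit_paths_Suc order_refl)

lemma path_prob_nonneg: "set xs \<subseteq> S \<Longrightarrow> 0 \<le> path_prob S q xs"
  unfolding path_prob_def jump_prob_def
  using q_nonneg qtot_pos by (intro prod_nonneg) (auto simp: subset_iff intro!: divide_nonneg_pos)

lemma path_hold_nonneg: "set xs \<subseteq> S \<Longrightarrow> 0 \<le> path_hold S q xs"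
  unfolding path_hold_def using qtot_pos
  by (intro sum_nonneg) (auto simp: subset_iff intro!: less_imp_le)

lemma return_paths_subset: "xs \<in> return_paths S z \<Longrightarrow> set xs \<subseteq> S"
  by (simp add: return_paths_def)

lemma has_sum_return_paths_iff:
  fixes f :: "'s list \<Rightarrow> real"
  assumes z: "z \<in> S" and f: "\<And>xs. xs \<in> return_paths S z \<Longrightarrow> 0 \<le> f xs"
    and f0: "\<And>xs. path_prob S q xs = 0 \<Longrightarrow> f xs = 0"
  shows "(f has_sum s) (return_paths S z) \<longleftrightarrow> (\<lambda>k. sum f (ret_paths z k)) \<longlonglongrightarrow> s"
proof -
  have "(f has_sum s) (return_paths S z) \<longleftrightarrow> (f has_sum s) (\<Union>k. ret_paths z k)"
    unfolding Union_ret_paths[OF z] by (intro has_sum_cong_neutral) (auto intro: f0)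
  also have "\<dots> \<longleftrightarrow> (\<lambda>k. sum f (ret_paths z k)) \<longlonglongrightarrow> s"
  proof (rule has_sum_iff_incseq_sums_tendsto)
    show "0 \<le> f xs" if "xs \<in> (\<Union>k. ret_paths z k)" for xs
      using that f unfolding Union_ret_paths[OF z] by blast
  qed (simp_all add: finite_ret_paths[OF z] incseq_ret_paths)
  finally show ?thesis .
qed

lemma path_prob_has_sum_iff:
  "z \<in> S \<Longrightarrow> (path_prob S q has_sum s) (return_paths S z) \<longleftrightarrow> ret z \<longlonglongrightarrow> s"
  by (subst has_sum_return_paths_iff)
     (auto simp: sum_path_prob_ret_paths intro!: path_prob_nonneg dest: return_paths_subset)

text \<open>Summability of \<open>w\<close> bounds the path sums of holding times uniformly in
  \<open>k\<close>, so the mean return time clause always holds and only certainty of return remains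
  to be decided.\<close>

lemma pos_recurrent_iff:
  assumes z: "z \<in> S" and w: "w summable_on S"
  shows "pos_recurrent S q z \<longleftrightarrow> ret z \<longlonglongrightarrow> 1"
proof -
  let ?f = "\<lambda>xs. path_prob S q xs * path_hold S q xs"
  have nonneg: "0 \<le> ?f xs" if "xs \<in> return_paths S z" for xs
    using path_prob_nonneg path_hold_nonneg return_paths_subset[OF that] by simp
  have nonneg': "0 \<le> ?f xs" if "xs \<in> ret_paths z k" for xs k
    using nonneg that Union_ret_paths[OF z] by blast
  have "incseq (\<lambda>k. sum ?f (ret_paths z k))"
    by (intro monoI sum_mono2 finite_ret_paths z monoD[OF incseq_ret_paths]) (auto intro: nonneg')
  moreover have "0 \<le> sum ?f (ret_paths z k)" for k
    by (intro sum_nonneg nonneg')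
  ultimately have "convergent (\<lambda>k. sum ?f (ret_paths z k))"
    using sum_path_hold_ret_paths[OF z w]
    by (intro Bseq_monoseq_convergent incseq_imp_monoseq
        BseqI'[of _ "1 / qtot S q z + infsum w S / flow z"]) auto
  then have "?f summable_on return_paths S z"
    unfolding convergent_def summable_on_def
    by (subst has_sum_return_paths_iff[OF z nonneg]) auto
  then show ?thesis
    by (simp add: pos_recurrent_def qtot_pos[OF z] path_prob_has_sum_iff[OF z])
qed

end

text \<open>Test the energy form of the smaller chain on the hitting probabilities of both chains, and bound
the mixed energy by AM-GM with a parameter \<open>t\<close> that is chosen at the end.\<close>
lemma ret_tendsto_1_antimono:
  assumes q: "reversible_chain S q w" and q': "reversible_chain S q' w"
    and le: "\<And>x y. x \<in> S \<Longrightarrow> y \<in> S \<Longrightarrow> x \<noteq> y \<Longrightarrow> q' x y \<le> q x y"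
    and z: "z \<in> S" and lim: "reversible_chain.ret S q z \<longlonglongrightarrow> 1"
  shows "reversible_chain.ret S q' z \<longlonglongrightarrow> 1"
proof -
  interpret A: reversible_chain S q w by fact
  interpret B: reversible_chain S q' w by fact
  have nbr_le: "B.nbr x \<subseteq> A.nbr x" if "x \<in> S" for x
    using that le[of x] by (force simp: A.nbr_def B.nbr_def)
  \<comment> \<open>The contribution of the states other than \<open>z\<close>. For fixed
    \<open>j\<close> it is a sum over a fixed finite ball, so it vanishes as \<open>k\<close> tends
    to infinity.\<close>
  define R where "R j k = (\<Sum>x\<in>A.nball z j - {z}. B.flow x * A.hit z j x * (B.hit z k x - B.hit z (Suc k) x))"
    for j k
  have main: "2 * B.flow z * (1 - B.ret z k) + 2 * R j k
      \<le> t * (A.flow z * (1 - A.ret z j)) + B.flow z / t" if t: "0 < t" for j k t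
  proof -
    define f where "f = A.hit z j"
    define g where "g = B.hit z k"
    define G where "G = A.nball z (Suc j) \<union> B.nball z (Suc k)"
    have G: "finite G" "G \<subseteq> S" "A.nball z (Suc j) \<subseteq> G" "B.nball z (Suc k) \<subseteq> G" "z \<in> G"
      unfolding G_def using A.finite_nball B.finite_nball A.nball_subset B.nball_subset z
      by (auto simp del: A.nball.simps B.nball.simps)
    have supp: "x \<in> G \<and> B.nbr x \<subseteq> G" if "x \<in> S" "f x \<noteq> 0" for x
    proof -
      have x: "x \<in> A.nball z j" using A.hit_support that by (simp add: f_def)
      then have "x \<in> G" using A.nball_mono[of j "Suc j" z] G(3) by auto
      moreover have "B.nbr x \<subseteq> G" using nbr_le[OF that(1)] A.nbr_nball[OF x] G(3) by blast
      ultimately show ?thesis ..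
    qed
    have "B.energy G f g = 2 * (\<Sum>x\<in>G. B.flow x * f x * (g x - B.avg g x))"
      using B.green(1)[OF G(1,2) supp] .
    also have "(\<Sum>x\<in>G. B.flow x * f x * (g x - B.avg g x))
        = B.flow z * (1 - B.ret z k) + (\<Sum>x\<in>G - {z}. B.flow x * f x * (g x - B.hit z (Suc k) x))"
      by (subst sum.remove[OF G(1,5)]) (simp add: f_def g_def B.ret_def)
    also have "(\<Sum>x\<in>G - {z}. B.flow x * f x * (g x - B.hit z (Suc k) x)) = R j k"
      unfolding R_def f_def g_def
    proof (rule sum.mono_neutral_right)
      show "A.nball z j - {z} \<subseteq> G - {z}" using G(3) A.nball_mono[of j "Suc j" z] by auto
    qed (use G A.hit_support[of _ z j] in auto)
    finally have "2 * (B.flow z * (1 - B.ret z k) + R j k) = B.energy G f g" by simp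
    \<comment> \<open>The estimate is made edge by edge. Domination of \<open>q'\<close> by
      \<open>q\<close> is applied only to the term with \<open>f\<close>, the test function of the
      larger chain.\<close>
    also have "\<dots> \<le> (t / 2) * A.energy G f f + (1 / (2 * t)) * B.energy G g g"
      unfolding A.energy_def B.energy_def sum_distrib_left sum.distrib[symmetric]
    proof (intro sum_mono)
      fix x y assume xy: "x \<in> G" "y \<in> G"
      show "w x * q' x y * (f x - f y) * (g x - g y)
        \<le> t / 2 * (w x * q x y * (f x - f y) * (f x - f y))
          + 1 / (2 * t) * (w x * q' x y * (g x - g y) * (g x - g y))"
      proof (cases "x = y")
        case False
        let ?a = "f x - f y" and ?b = "g x - g y"
        have c: "0 \<le> w x * q' x y" "w x * q' x y \<le> w x * q x y"
          using A.w_pos[of x] B.q_nonneg[of x y] le[of x y] xy G False by (auto simp: subset_iff)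
        have "0 \<le> (t * ?a - ?b)\<^sup>2 / (2 * t)" using t by simp
        then have "?a * ?b \<le> t / 2 * (?a * ?a) + 1 / (2 * t) * (?b * ?b)"
          using t by (simp add: power2_eq_square field_simps)
        then have "w x * q' x y * (?a * ?b)
            \<le> w x * q' x y * (t / 2 * (?a * ?a) + 1 / (2 * t) * (?b * ?b))"
          using c(1) by (rule mult_left_mono)
        also have "\<dots> = w x * q' x y * (t / 2 * (?a * ?a)) + w x * q' x y * (1 / (2 * t) * (?b * ?b))"
          by (rule distrib_left)
        also have "w x * q' x y * (t / 2 * (?a * ?a)) \<le> w x * q x y * (t / 2 * (?a * ?a))"
          using c(2) t by (intro mult_right_mono) auto
        finally show ?thesis by (simp add: mult_ac)
      qed simp
    qed
    also have "\<dots> \<le> (t / 2) * (2 * A.flow z * (1 - A.ret z j)) + (1 / (2 * t)) * (2 * B.flow z * (1 - B.ret z k))"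
      unfolding f_def g_def using t
      by (intro add_mono mult_left_mono A.energy_hit_le B.energy_hit_le z G) auto
    also have "(1 / (2 * t)) * (2 * B.flow z * (1 - B.ret z k)) \<le> (1 / (2 * t)) * (2 * B.flow z)"
      using t B.ret_bounds[OF z, of k] B.flow_pos[OF z] by (intro mult_left_mono) auto
    finally show ?thesis by simp
  qed
  \<comment> \<open>The limit in \<open>k\<close> is taken first and removes \<open>R\<close>; the
    limit in \<open>j\<close> then removes the energy of the larger chain, and \<open>t\<close> is
    chosen last.\<close>
  obtain u where u: "B.ret z \<longlonglongrightarrow> u"
    using B.ret_convergent[OF z] by (auto simp: convergent_def)
  have R0: "R j \<longlonglongrightarrow> 0" for j
    unfolding R_def
  proof (rule tendsto_null_sum)
    fix x assume "x \<in> A.nball z j - {z}"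
    then have "x \<in> S" using A.nball_subset[OF z, of j] by blast
    then obtain l where "(\<lambda>k. B.hit z k x) \<longlonglongrightarrow> l"
      using B.hit_convergent by (auto simp: convergent_def)
    then have "(\<lambda>k. B.hit z k x - B.hit z (Suc k) x) \<longlonglongrightarrow> l - l"
      by (intro tendsto_diff LIMSEQ_Suc)
    then show "(\<lambda>k. B.flow x * A.hit z j x * (B.hit z k x - B.hit z (Suc k) x)) \<longlonglongrightarrow> 0"
      by (intro tendsto_mult_right_zero) simp
  qed
  have "2 * B.flow z * (1 - u) \<le> B.flow z / t" if t: "0 < t" for t
  proof -
    have "2 * B.flow z * (1 - u) \<le> t * (A.flow z * (1 - A.ret z j)) + B.flow z / t" for j
    proof (rule LIMSEQ_le_const2)
      show "(\<lambda>k. 2 * B.flow z * (1 - B.ret z k) + 2 * R j k) \<longlonglongrightarrow> 2 * B.flow z * (1 - u)"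
        using tendsto_add[OF tendsto_mult_left[OF tendsto_diff[OF tendsto_const[of 1] u], of "2 * B.flow z"]
            tendsto_mult_left[OF R0, of 2]] by simp
    qed (use main[OF t] in auto)
    moreover have "(\<lambda>j. t * (A.flow z * (1 - A.ret z j)) + B.flow z / t)
        \<longlonglongrightarrow> t * (A.flow z * (1 - 1)) + B.flow z / t"
      by (intro tendsto_intros lim)
    ultimately show ?thesis by (intro LIMSEQ_le_const) auto
  qed
  \<comment> \<open>If \<open>u < 1\<close>, this \<open>t\<close> makes the right-hand side
    \<open>B.flow z * (1 - u)\<close>, which is half of the positive left-hand side.\<close>
  from this[of "inverse (1 - u)"] have "1 \<le> u"
    using B.flow_pos[OF z] by (cases "1 \<le> u") (auto simp: field_simps)
  moreover have "u \<le> 1" using LIMSEQ_le_const2[OF u] B.ret_bounds[OF z] by blast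
  ultimately show ?thesis using u by simp
qed

section \<open>Stationarity and closed subspaces\<close>

lemma summable_on_finite_support:
  fixes f :: "'a \<Rightarrow> real"
  assumes "finite {x \<in> A. f x \<noteq> 0}"
  shows "f summable_on A"
  using assms by (subst summable_on_cong_neutral[where T = "{x \<in> A. f x \<noteq> 0}" and g = f]) auto

lemma stationary_dist_detailed_balance:
  assumes nonneg: "\<And>n. n \<in> S \<Longrightarrow> 0 \<le> \<pi> n" and sum: "(\<pi> has_sum 1) S"
    and fin: "\<And>n. n \<in> S \<Longrightarrow> finite {m \<in> S. q n m \<noteq> 0}"
    and balance: "\<And>n m. n \<in> S \<Longrightarrow> m \<in> S \<Longrightarrow> n \<noteq> m \<Longrightarrow> \<pi> n * q n m = \<pi> m * q m n"
  shows "stationary_dist S q \<pi>"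
  unfolding stationary_dist_def
proof (intro conjI ballI)
  fix n assume n: "n \<in> S"
  have "(\<lambda>m. \<pi> n * q n m) summable_on (S - {n})"
    by (intro summable_on_finite_support finite_subset[OF _ fin[OF n]]) auto
  then show "(\<lambda>m. \<pi> m * q m n) summable_on (S - {n})"
    by (rule summable_on_cong[THEN iffD1, rotated]) (use balance[OF n] in auto)
  have "\<pi> n * qtot S q n = infsum (\<lambda>m. \<pi> n * q n m) (S - {n})"
    unfolding qtot_def by (rule infsum_cmult_right'[symmetric])
  also have "\<dots> = infsum (\<lambda>m. \<pi> m * q m n) (S - {n})"
    by (rule infsum_cong) (use balance[OF n] in auto)
  finally show "\<pi> n * qtot S q n = infsum (\<lambda>m. \<pi> m * q m n) (S - {n})" .
qed (use nonneg sum in auto)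

lemma closed_subspace_rtrancl:
  assumes closed: "closed_subspace S q A" and "(n, m) \<in> (trans_rel S q)\<^sup>*" "n \<in> A"
  shows "m \<in> A"
  using assms(2,3)
proof (induction rule: rtrancl_induct)
  case (step x y)
  then show ?case using closed by (cases "y \<in> A") (auto simp: trans_rel_def closed_subspace_def)
qed

section \<open>Sums over product state spaces\<close>

lemma has_sum_Times_real:
  fixes f :: "'a \<Rightarrow> real" and g :: "'b \<Rightarrow> real"
  assumes f: "(f has_sum a) A" and g: "(g has_sum b) B"
    and nonneg: "\<And>x. x \<in> A \<Longrightarrow> 0 \<le> f x" "\<And>y. y \<in> B \<Longrightarrow> 0 \<le> g y"
  shows "((\<lambda>(x, y). f x * g y) has_sum a * b) (A \<times> B)"
proof (rule has_sum_SigmaI)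
  show inner: "((\<lambda>y. case (x, y) of (x, y) \<Rightarrow> f x * g y) has_sum f x * b) B" for x
    using has_sum_cmult_right[OF g, of "f x"] by simp
  show outer: "((\<lambda>x. f x * b) has_sum a * b) A"
    by (rule has_sum_cmult_left[OF f])
  show "(\<lambda>(x, y). f x * g y) summable_on A \<times> B"
    using inner outer nonneg by (intro summable_on_SigmaI[where g = "\<lambda>x. f x * b"])
      (auto simp: summable_on_def)
qed

lemma restrict_to_upd: "i \<notin> B \<Longrightarrow> restrict_to B (n(i := k)) = restrict_to B n"
  by (auto simp: restrict_to_def)

text \<open>Used to normalise both \<open>xi\<close> and \<open>xi_phi\<close>. Induction adds one
  coordinate \<open>a\<close> at a time: updating at \<open>a\<close> identifies pairs of a value
  and a state with the enlarged index set, and \<open>\<phi>\<close> is untouched since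
  \<open>a\<close> lies outside \<open>B\<close>.\<close>

lemma has_sum_prod_coordinates:
  fixes f :: "nat \<Rightarrow> nat \<Rightarrow> real"
  assumes "finite A" and "A \<inter> B = {}"
    and f: "\<And>j. j \<in> A \<Longrightarrow> (f j has_sum s j) UNIV" "\<And>j k. j \<in> A \<Longrightarrow> 0 \<le> f j k"
    and \<phi>: "(\<phi> has_sum t) {b. \<forall>k. k \<notin> B \<longrightarrow> b k = 0}"
      "\<And>b. \<forall>k. k \<notin> B \<longrightarrow> b k = 0 \<Longrightarrow> 0 \<le> \<phi> b"
  shows "((\<lambda>n. (\<Prod>j\<in>A. f j (n j)) * \<phi> (restrict_to B n)) has_sum (\<Prod>j\<in>A. s j) * t)
    {n. \<forall>k. k \<notin> A \<union> B \<longrightarrow> n k = 0}"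
  using assms(1,2) f
proof (induction A rule: finite_induct)
  case empty
  have "restrict_to B b = b" if "\<forall>k. k \<notin> B \<longrightarrow> b k = 0" for b
    using that by (auto simp: restrict_to_def)
  then show ?case using \<phi>(1) by (subst has_sum_cong[where g = \<phi>]) auto
next
  case (insert a A)
  let ?X = "{n. \<forall>k. k \<notin> A \<union> B \<longrightarrow> n k = (0::nat)}"
  let ?Y = "{n. \<forall>k. k \<notin> insert a A \<union> B \<longrightarrow> n k = (0::nat)}"
  let ?w = "\<lambda>n. (\<Prod>j\<in>A. f j (n j)) * \<phi> (restrict_to B n)"
  let ?u = "\<lambda>(k, n). n(a := k) :: nat \<Rightarrow> nat"
  have a: "a \<notin> A" "a \<notin> B" using insert by auto
  have "((\<lambda>(k, n). f a k * ?w n) has_sum s a * ((\<Prod>j\<in>A. s j) * t)) (UNIV \<times> ?X)"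
  proof (rule has_sum_Times_real)
    show "(?w has_sum (\<Prod>j\<in>A. s j) * t) ?X" using insert by auto
    show "0 \<le> ?w n" for n
      using insert.prems \<phi>(2)[of "restrict_to B n"]
      by (intro mult_nonneg_nonneg prod_nonneg) (auto simp: restrict_to_def)
  qed (use insert in auto)
  also have "(\<lambda>(k, n). f a k * ?w n)
    = (\<lambda>n. (\<Prod>j\<in>insert a A. f j (n j)) * \<phi> (restrict_to B n)) \<circ> ?u"
  proof -
    have "(\<Prod>j\<in>A. f j (n j)) = (\<Prod>j\<in>A. f j ((n(a := k)) j))" for k n
      using a by (intro prod.cong) auto
    then show ?thesis
      using a insert.hyps by (auto simp: fun_eq_iff restrict_to_upd)
  qed
  also have "(\<dots> has_sum s a * ((\<Prod>j\<in>A. s j) * t)) (UNIV \<times> ?X) \<longleftrightarrow>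
    ((\<lambda>n. (\<Prod>j\<in>insert a A. f j (n j)) * \<phi> (restrict_to B n)) has_sum s a * ((\<Prod>j\<in>A. s j) * t))
      (?u ` (UNIV \<times> ?X))"
  proof (rule has_sum_reindex[symmetric])
    show "inj_on ?u (UNIV \<times> ?X)"
    proof (rule inj_onI, clarify)
      fix k n l m
      assume X: "\<forall>k. k \<notin> A \<union> B \<longrightarrow> n k = (0::nat)" "\<forall>k. k \<notin> A \<union> B \<longrightarrow> m k = (0::nat)"
        and eq: "n(a := k) = m(a := l)"
      have "n x = m x" for x
        using X a fun_cong[OF eq, of x] by (cases "x = a") auto
      then show "k = l \<and> n = m" using fun_cong[OF eq, of a] by auto
    qed
  qed
  also have "?u ` (UNIV \<times> ?X) = ?Y"
  proof (intro equalityI subsetI)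
    fix n assume "n \<in> ?Y"
    then show "n \<in> ?u ` (UNIV \<times> ?X)"
      by (intro image_eqI[of _ _ "(n a, n(a := 0))"]) auto
  qed auto
  finally show ?case using insert.hyps by (simp add: mult.assoc)
qed

section \<open>Jackson networks with reversible routing\<close>

lemma states_upd: "n \<in> states J \<Longrightarrow> i \<in> {1..J} \<Longrightarrow> n(i := k) \<in> states J"
  by (auto simp: states_def)

text \<open>Pairs a transition with its reverse, including the positivity guard on the node that is
  left. With \<open>move_iff\<close> it matches the terms of the two rates in detailed
  balance.\<close>

lemma up_down_iff: "m = n(i := n i + 1) \<longleftrightarrow> 0 < m i \<and> n = m(i := m i - 1)"
  for n m :: "nat \<Rightarrow> nat"
  by (auto simp: fun_eq_iff)

lemma move_iff: "0 < n j \<and> m = n(j := n j - 1, i := n i + 1) \<longleftrightarrow> 0 < m i \<and> n = m(i := m i - 1, j := m j + 1)"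
  if "i \<noteq> j" for n m :: "nat \<Rightarrow> nat"
  using that by (auto simp: fun_eq_iff)

locale reversible_jackson =
  fixes J :: nat and L :: real and mu :: "nat \<Rightarrow> nat \<Rightarrow> real"
    and r :: "nat \<Rightarrow> nat \<Rightarrow> real" and \<eta> :: "nat \<Rightarrow> real"
  assumes mu_pos: "\<And>j k. j \<in> {1..J} \<Longrightarrow> 0 < k \<Longrightarrow> 0 < mu j k"
    and r_nonneg: "\<And>i j. i \<in> {0..J} \<Longrightarrow> j \<in> {0..J} \<Longrightarrow> 0 \<le> r i j"
    and eta_pos: "\<And>j. j \<in> {0..J} \<Longrightarrow> 0 < \<eta> j"
    and eta_0: "\<eta> 0 = L"
    and r_rev: "\<And>i j. i \<in> {0..J} \<Longrightarrow> j \<in> {0..J} \<Longrightarrow> \<eta> i * r i j = \<eta> j * r j i"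
    and C_fin: "\<And>j. j \<in> {1..J} \<Longrightarrow> summable (\<lambda>n. \<Prod>k\<in>{1..n}. \<eta> j / mu j k)"
begin

text \<open>\<open>g\<close> enters twice, as service factor and through the routing modification,
  so a move from \<open>j\<close> to \<open>i\<close> carries the symmetric factor
  \<open>g j * g i\<close>. The constant 1 recovers the original network.\<close>

definition rate :: "(nat \<Rightarrow> real) \<Rightarrow> (nat \<Rightarrow> nat) \<Rightarrow> (nat \<Rightarrow> nat) \<Rightarrow> real" where
  "rate g = jrate J L (rr_mod J r (alpha_of g)) mu g"

lemma L_pos: "0 < L"
  using eta_pos[of 0] eta_0 by simp

text \<open>Only off-diagonal entries of \<open>rr_mod\<close> occur, so the self-loops created by
  reflection drop out. Moving \<open>i \<noteq> j\<close> from the index set into the condition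
  allows the double sum to be interchanged later.\<close>

lemma rate_eq:
  "rate g n m =
     (\<Sum>i\<in>{1..J}. if m = n(i := n i + 1) then L * (r 0 i * g i) else 0)
   + (\<Sum>j\<in>{1..J}. \<Sum>i\<in>{1..J}. if i \<noteq> j \<and> 0 < n j \<and> m = n(j := n j - 1, i := n i + 1)
        then g j * mu j (n j) * (r j i * g i) else 0)
   + (\<Sum>j\<in>{1..J}. if 0 < n j \<and> m = n(j := n j - 1) then g j * mu j (n j) * r j 0 else 0)"
proof -
  have *: "(\<Sum>i\<in>{1..J} - {j}. if 0 < n j \<and> m = n(j := n j - 1, i := n i + 1)
        then g j * mu j (n j) * rr_mod J r (alpha_of g) j i else 0) =
      (\<Sum>i\<in>{1..J}. if i \<noteq> j \<and> 0 < n j \<and> m = n(j := n j - 1, i := n i + 1)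
        then g j * mu j (n j) * (r j i * g i) else 0)" for j
    by (rule sum.mono_neutral_cong_left) (auto simp: rr_mod_def alpha_of_def)
  show ?thesis
    unfolding rate_def jrate_def *
    by (intro arg_cong2[where f = "(+)"] sum.cong refl) (auto simp: rr_mod_def alpha_of_def)
qed

lemma rate_one: "rate (\<lambda>_. 1) = jrate J L r mu (\<lambda>_. 1)"
  unfolding rate_def jrate_def fun_eq_iff
  by (intro allI arg_cong2[where f = "(+)"] sum.cong refl) (auto simp: rr_mod_def alpha_of_def)

section \<open>Comparison, positivity and support of the rates\<close>

lemma rate_eq_0I:
  assumes "\<And>i. i \<in> {1..J} \<Longrightarrow> m = n(i := n i + 1) \<Longrightarrow> g i = 0"
    and "\<And>i j. i \<in> {1..J} \<Longrightarrow> j \<in> {1..J} \<Longrightarrow> m = n(j := n j - 1, i := n i + 1) \<Longrightarrow> g j = 0 \<or> g i = 0"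
    and "\<And>j. j \<in> {1..J} \<Longrightarrow> m = n(j := n j - 1) \<Longrightarrow> g j = 0"
  shows "rate g n m = 0"
proof -
  have *: "a + b + c = 0" if "a = 0" "b = 0" "c = 0" for a b c :: real
    using that by simp
  show ?thesis
    unfolding rate_eq by (intro * sum.neutral ballI) (use assms in auto)
qed

text \<open>Each summand is a product of nonnegative constants and factors from \<open>g\<close>.
  This is the domination needed for comparing recurrence.\<close>

lemma rate_mono:
  assumes g: "\<And>i. i \<in> {1..J} \<Longrightarrow> 0 \<le> g i \<and> g i \<le> h i"
  shows "rate g n m \<le> rate h n m"
proof -
  have "g i * (mu i (n i) * r i k) \<le> h i * (mu i (n i) * r i k)"
    if "i \<in> {1..J}" "k \<in> {0..J}" "0 < n i" for i k
    using g[of i] mu_pos[of i "n i"] r_nonneg[of i k] that by (intro mult_right_mono) auto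
  moreover have "g i * (mu i (n i) * r i k) * g k \<le> h i * (mu i (n i) * r i k) * h k"
    if "i \<in> {1..J}" "k \<in> {1..J}" "0 < n i" for i k
    using g[of i] g[of k] mu_pos[of i "n i"] r_nonneg[of i k] that
    by (intro mult_mono) auto
  moreover have "L * (r 0 i * g i) \<le> L * (r 0 i * h i)" if "i \<in> {1..J}" for i
    using g[of i] r_nonneg[of 0 i] L_pos that by (intro mult_left_mono) auto
  ultimately show ?thesis
    unfolding rate_eq by (intro add_mono sum_mono) (auto simp: mult_ac)
qed

lemma rate_nonneg:
  assumes "\<And>i. i \<in> {1..J} \<Longrightarrow> 0 \<le> g i"
  shows "0 \<le> rate g n m"
proof -
  have "rate (\<lambda>_. 0) n m = 0" by (simp add: rate_eq cong: if_cong)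
  then show ?thesis using rate_mono[of "\<lambda>_. 0" g n m] assms by simp
qed

text \<open>Arrivals and departures carry one factor \<open>c\<close>, internal moves two;
  \<open>c * c \<le> c\<close> covers both.\<close>

lemma rate_const_ge:
  assumes "0 \<le> c" "c \<le> 1"
  shows "c\<^sup>2 * rate (\<lambda>_. 1) n m \<le> rate (\<lambda>_. c) n m"
proof -
  have c: "c * c \<le> c" using assms by (simp add: mult_left_le)
  have "c * c * (L * r 0 i) \<le> c * (L * r 0 i)" if "i \<in> {1..J}" for i
    using r_nonneg[of 0 i] L_pos that by (intro mult_right_mono c) auto
  moreover have "c * c * (mu i (n i) * r i 0) \<le> c * (mu i (n i) * r i 0)"
    if "i \<in> {1..J}" "0 < n i" for i
    using r_nonneg[of i 0] mu_pos[of i "n i"] that by (intro mult_right_mono c) auto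
  ultimately show ?thesis
    unfolding rate_eq distrib_left sum_distrib_left power2_eq_square
    by (intro add_mono sum_mono) (auto simp: mult_ac)
qed

lemma rate_pos:
  assumes g: "\<And>i. i \<in> {1..J} \<Longrightarrow> 0 < g i" and pos: "0 < rate (\<lambda>_. 1) n m"
  shows "0 < rate g n m"
proof -
  \<comment> \<open>Inserting 1 ensures \<open>c \<le> 1\<close> and keeps the minimum defined when
    there are no nodes.\<close>
  define c where "c = Min (insert 1 (g ` {1..J}))"
  have c: "0 < c" "c \<le> 1"
    using g by (auto simp: c_def)
  have cg: "c \<le> g i" if "i \<in> {1..J}" for i
    unfolding c_def by (rule Min_le) (use that in auto)
  have "0 < c\<^sup>2 * rate (\<lambda>_. 1) n m" using c pos by simp
  also have "\<dots> \<le> rate (\<lambda>_. c) n m" using c by (intro rate_const_ge) auto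
  also have "\<dots> \<le> rate g n m" using c cg by (intro rate_mono) auto
  finally show ?thesis .
qed

lemma finite_rate_support: "finite {m. rate g n m \<noteq> 0}"
proof (rule finite_subset)
  let ?I = "{1..J}"
  let ?M = "(\<Union>i\<in>?I. {n(i := n i + 1)}) \<union> (\<Union>j\<in>?I. \<Union>i\<in>?I. {n(j := n j - 1, i := n i + 1)})
    \<union> (\<Union>j\<in>?I. {n(j := n j - 1)})"
  show "finite ?M" by auto
  show "{m. rate g n m \<noteq> 0} \<subseteq> ?M"
  proof (rule subsetI, rule ccontr)
    fix m assume m: "m \<in> {m. rate g n m \<noteq> 0}" "m \<notin> ?M"
    have "rate g n m = 0" by (rule rate_eq_0I) (use m(2) in blast)+
    then show False using m(1) by simp
  qed
qed

text \<open>The one-coordinate relation is demanded only after multiplication by \<open>g i\<close>;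
  it is trivial at blocked nodes, which leaves room for arbitrary weights there. Arrivals are
  matched with departures and moves with reverse moves, and reversibility of \<open>r\<close>
  equates the routing factors.\<close>

lemma rate_balance:
  assumes n: "n \<in> states J" and m: "m \<in> states J"
    and w: "\<And>n i. n \<in> states J \<Longrightarrow> i \<in> {1..J} \<Longrightarrow>
      w (n(i := n i + 1)) * mu i (n i + 1) * g i = w n * \<eta> i * g i"
  shows "w n * rate g n m = w m * rate g m n"
proof -
  have down: "w n * (g i * mu i (n i)) = w (n(i := n i - 1)) * \<eta> i * g i"
    if "n \<in> states J" "i \<in> {1..J}" "0 < n i" for n i
    using w[of "n(i := n i - 1)" i] states_upd that by (simp add: mult_ac)
  define T1 where "T1 n m = (\<Sum>i\<in>{1..J}. if m = n(i := n i + 1) then L * (r 0 i * g i) else 0)"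
    for n m :: "nat \<Rightarrow> nat"
  define t2 where "t2 n m j i = (if i \<noteq> j \<and> 0 < n j \<and> m = n(j := n j - 1, i := n i + 1)
        then g j * mu j (n j) * (r j i * g i) else 0)" for n m :: "nat \<Rightarrow> nat" and j i
  define T3 where "T3 n m = (\<Sum>j\<in>{1..J}. if 0 < n j \<and> m = n(j := n j - 1) then g j * mu j (n j) * r j 0 else 0)"
    for n m :: "nat \<Rightarrow> nat"
  have rate: "rate g n m = T1 n m + (\<Sum>j\<in>{1..J}. \<Sum>i\<in>{1..J}. t2 n m j i) + T3 n m" for n m
    by (simp add: rate_eq T1_def t2_def T3_def)
  have *: "u * (l * (r0 * x)) = v * (x * y * r1)"
    if "v * (x * y) = u * e * x" "e * r1 = l * r0" for u v x y r0 r1 l e :: real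
  proof -
    have "v * (x * y * r1) = v * (x * y) * r1" by (simp only: mult_ac)
    also have "\<dots> = u * x * (e * r1)" by (simp only: that(1) mult_ac)
    also have "\<dots> = u * (l * (r0 * x))" by (simp only: that(2) mult_ac)
    finally show ?thesis by (rule sym)
  qed
  have 13: "w n * T1 n m = w m * T3 m n" if m: "m \<in> states J" for n m
    unfolding T1_def T3_def sum_distrib_left
  proof (intro sum.cong refl)
    fix i assume i: "i \<in> {1..J}"
    have "w n * (L * (r 0 i * g i)) = w m * (g i * mu i (m i) * r i 0)"
      if "0 < m i" "n = m(i := m i - 1)"
    proof -
      have "w m * (g i * mu i (m i)) = w n * \<eta> i * g i"
        unfolding that(2) by (rule down[OF m i that(1)])
      moreover have "\<eta> i * r i 0 = L * r 0 i" using r_rev[of i 0] i eta_0 by simp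
      ultimately show ?thesis by (rule *)
    qed
    then show "w n * (if m = n(i := n i + 1) then L * (r 0 i * g i) else 0)
      = w m * (if 0 < m i \<and> n = m(i := m i - 1) then g i * mu i (m i) * r i 0 else 0)"
      unfolding up_down_iff[of m n i] by simp
  qed
  have 2: "w n * t2 n m j i = w m * t2 m n i j" if ij: "i \<in> {1..J}" "j \<in> {1..J}" for i j
  proof (cases "i \<noteq> j \<and> 0 < n j \<and> m = n(j := n j - 1, i := n i + 1)")
    case True
    \<comment> \<open>The state with the moving customer in transit: removing it at \<open>j\<close>
      from \<open>n\<close> or at \<open>i\<close> from \<open>m\<close> gives the same
      \<open>k\<close>. Both flows are expressed through \<open>w k\<close>.\<close>
    define k where "k = n(j := n j - 1)"
    have rev: "j \<noteq> i \<and> 0 < m i \<and> n = m(i := m i - 1, j := m j + 1)"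
      using True move_iff[of i j n m] by blast
    have k: "k = m(i := m i - 1)" using True by (auto simp: k_def)
    have "w n * (g j * mu j (n j)) = w k * \<eta> j * g j"
      unfolding k_def using True by (intro down[OF n ij(2)]) blast
    moreover have "w m * (g i * mu i (m i)) = w k * \<eta> i * g i"
      unfolding k using rev by (intro down[OF m ij(1)]) blast
    moreover have "\<eta> j * r j i = \<eta> i * r i j" using r_rev[of j i] ij by simp
    moreover have "w k * \<eta> j * g j * (r j i * g i) = w k * g j * g i * (\<eta> j * r j i)"
      "w k * \<eta> i * g i * (r i j * g j) = w k * g j * g i * (\<eta> i * r i j)"
      by (simp_all only: mult_ac)
    ultimately have "w n * (g j * mu j (n j)) * (r j i * g i) = w m * (g i * mu i (m i)) * (r i j * g j)"
      by (simp only:)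
    then show ?thesis unfolding t2_def if_P[OF True] if_P[OF rev] by (simp only: mult.assoc)
  next
    case False
    then have rev: "\<not> (j \<noteq> i \<and> 0 < m i \<and> n = m(i := m i - 1, j := m j + 1))"
      using move_iff[of i j n m] by blast
    show ?thesis unfolding t2_def if_not_P[OF False] if_not_P[OF rev] by (simp only: mult_zero_right)
  qed
  have "w n * (\<Sum>j\<in>{1..J}. \<Sum>i\<in>{1..J}. t2 n m j i) = (\<Sum>j\<in>{1..J}. \<Sum>i\<in>{1..J}. w m * t2 m n i j)"
    unfolding sum_distrib_left by (intro sum.cong refl 2)
  also have "\<dots> = w m * (\<Sum>i\<in>{1..J}. \<Sum>j\<in>{1..J}. t2 m n i j)"
    unfolding sum_distrib_left by (rule sum.swap)
  finally show ?thesis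
    using 13[OF m, of n] 13[OF n, of m] by (simp add: rate distrib_left)
qed

section \<open>Product-form stationary distributions\<close>

definition marginal :: "nat \<Rightarrow> nat \<Rightarrow> real" where
  "marginal j n = (\<Prod>k\<in>{1..n}. \<eta> j / mu j k) / Cnorm \<eta> mu j"

lemma Cnorm_pos: "j \<in> {1..J} \<Longrightarrow> 0 < Cnorm \<eta> mu j"
  unfolding Cnorm_def using eta_pos[of j] mu_pos[of j]
  by (intro suminf_pos C_fin prod_pos) auto

lemma marginal_pos: "j \<in> {1..J} \<Longrightarrow> 0 < marginal j n"
  unfolding marginal_def using eta_pos[of j] mu_pos[of j] Cnorm_pos[of j]
  by (intro divide_pos_pos prod_pos) auto

lemma marginal_nonneg: "j \<in> {1..J} \<Longrightarrow> 0 \<le> marginal j n"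
  by (rule less_imp_le[OF marginal_pos])

lemma marginal_Suc: "j \<in> {1..J} \<Longrightarrow> marginal j (n + 1) * mu j (n + 1) = marginal j n * \<eta> j"
  using mu_pos[of j "n + 1"] by (simp add: marginal_def field_simps)

lemma marginal_has_sum:
  assumes j: "j \<in> {1..J}"
  shows "(marginal j has_sum 1) UNIV"
proof -
  have "marginal j sums (Cnorm \<eta> mu j / Cnorm \<eta> mu j)"
    unfolding marginal_def[abs_def] Cnorm_def by (intro sums_divide summable_sums C_fin j)
  then show ?thesis
    using Cnorm_pos[OF j] marginal_nonneg[OF j] by (intro sums_nonneg_imp_has_sum) auto
qed

lemma xi_phi_eq: "xi_phi W B \<eta> mu \<phi> n = (\<Prod>j\<in>W. marginal j (n j)) * \<phi> (restrict_to B n)"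
  by (simp add: xi_phi_def marginal_def)

text \<open>Lets normalisation and balance be proved once, for \<open>xi_phi\<close>. With an empty
  second block the only argument of \<open>\<phi>\<close> is the zero function, on which the
  constant 1 is the point mass.\<close>

lemma xi_eq_xi_phi: "xi J \<eta> mu = xi_phi {1..J} {} \<eta> mu (\<lambda>_. 1)"
  by (simp add: xi_def xi_phi_def fun_eq_iff)

lemma xi_phi_upd:
  assumes W: "W \<subseteq> {1..J}" "W \<inter> B = {}" and i: "i \<in> W"
  shows "xi_phi W B \<eta> mu \<phi> (n(i := n i + 1)) * mu i (n i + 1) = xi_phi W B \<eta> mu \<phi> n * \<eta> i"
proof -
  have fin: "finite W" using W finite_subset by blast
  have rest: "(\<Prod>j\<in>W - {i}. marginal j ((n(i := n i + 1)) j)) = (\<Prod>j\<in>W - {i}. marginal j (n j))"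
    by (intro prod.cong) auto
  have restrict: "restrict_to B (n(i := n i + 1)) = restrict_to B n"
    using i W by (intro restrict_to_upd) auto
  have eq: "a' * p * f * u = a * p * f * e" if "a' * u = a * e" for a a' p f u e :: real
    using arg_cong[OF that, of "\<lambda>x. x * (p * f)"] by (simp only: mult_ac)
  show ?thesis
    unfolding xi_phi_eq prod.remove[OF fin i] rest restrict fun_upd_same
    by (rule eq, rule marginal_Suc) (use i W in auto)
qed

lemma xi_phi_has_sum:
  assumes W: "W \<subseteq> {1..J}" "W \<inter> B = {}" "W \<union> B = {1..J}"
    and \<phi>: "\<And>b. \<forall>k. k \<notin> B \<longrightarrow> b k = 0 \<Longrightarrow> 0 \<le> \<phi> b" "(\<phi> has_sum 1) {b. \<forall>k. k \<notin> B \<longrightarrow> b k = 0}"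
  shows "(xi_phi W B \<eta> mu \<phi> has_sum 1) (states J)"
proof -
  have "((\<lambda>n. (\<Prod>j\<in>W. marginal j (n j)) * \<phi> (restrict_to B n)) has_sum (\<Prod>j\<in>W. 1) * 1)
      {n. \<forall>k. k \<notin> W \<union> B \<longrightarrow> n k = 0}"
    using W \<phi> finite_subset[OF W(1)]
    by (intro has_sum_prod_coordinates marginal_has_sum marginal_nonneg) blast+
  then show ?thesis unfolding W(3) by (simp add: states_def xi_phi_eq[abs_def])
qed

lemma xi_phi_nonneg:
  assumes "W \<subseteq> {1..J}" and "\<And>b. \<forall>k. k \<notin> B \<longrightarrow> b k = 0 \<Longrightarrow> 0 \<le> \<phi> b"
  shows "0 \<le> xi_phi W B \<eta> mu \<phi> n"
  unfolding xi_phi_eq using assms marginal_nonneg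
  by (intro mult_nonneg_nonneg prod_nonneg) (auto simp: restrict_to_def subset_iff)

text \<open>At nodes of \<open>W\<close> balance comes from the recursion of the marginals; at nodes
  of \<open>B\<close> both sides contain \<open>g i = 0\<close>, so \<open>\<phi>\<close> may be any
  distribution.\<close>

lemma stationary_xi_phi:
  assumes W: "W \<subseteq> {1..J}" "W \<inter> B = {}" "W \<union> B = {1..J}"
    and g: "\<And>i. i \<in> B \<Longrightarrow> g i = 0"
    and \<phi>: "\<And>b. \<forall>k. k \<notin> B \<longrightarrow> b k = 0 \<Longrightarrow> 0 \<le> \<phi> b" "(\<phi> has_sum 1) {b. \<forall>k. k \<notin> B \<longrightarrow> b k = 0}"
  shows "stationary_dist (states J) (rate g) (xi_phi W B \<eta> mu \<phi>)"
proof (rule stationary_dist_detailed_balance)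
  fix n m assume nm: "n \<in> states J" "m \<in> states J"
  show "xi_phi W B \<eta> mu \<phi> n * rate g n m = xi_phi W B \<eta> mu \<phi> m * rate g m n"
  proof (rule rate_balance[OF nm])
    fix n :: "nat \<Rightarrow> nat" and i assume i: "i \<in> {1..J}"
    show "xi_phi W B \<eta> mu \<phi> (n(i := n i + 1)) * mu i (n i + 1) * g i
      = xi_phi W B \<eta> mu \<phi> n * \<eta> i * g i"
    proof (cases "i \<in> W")
      case True
      then show ?thesis by (simp only: xi_phi_upd[OF W(1,2)])
    qed (use W g i in auto)
  qed
next
  show "finite {m \<in> states J. rate g n m \<noteq> 0}" for n
    using finite_rate_support[of g n] by (rule rev_finite_subset) auto
qed (use xi_phi_nonneg[OF W(1)] xi_phi_has_sum[OF W] \<phi> in blast)+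

lemma has_sum_zero_state: "((\<lambda>_. 1::real) has_sum 1) {b :: nat \<Rightarrow> nat. \<forall>k. k \<notin> {} \<longrightarrow> b k = 0}"
proof -
  have "{b :: nat \<Rightarrow> nat. \<forall>k. k \<notin> {} \<longrightarrow> b k = 0} = {\<lambda>_. 0}" by auto
  then show ?thesis using has_sum_finite[of "{\<lambda>_::nat. 0::nat}" "\<lambda>_. 1::real"] by simp
qed

lemma xi_pos: "0 < xi J \<eta> mu n"
  unfolding xi_eq_xi_phi xi_phi_eq using marginal_pos by (auto intro: prod_pos)

lemma xi_has_sum: "(xi J \<eta> mu has_sum 1) (states J)"
  unfolding xi_eq_xi_phi by (intro xi_phi_has_sum has_sum_zero_state) auto

lemma xi_balance:
  assumes "n \<in> states J" "m \<in> states J"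
  shows "xi J \<eta> mu n * rate g n m = xi J \<eta> mu m * rate g m n"
  by (rule rate_balance[OF assms]) (simp only: xi_eq_xi_phi xi_phi_upd[OF order_refl Int_empty_right])

lemma stationary_xi: "stationary_dist (states J) (rate g) (xi J \<eta> mu)"
  unfolding xi_eq_xi_phi by (intro stationary_xi_phi has_sum_zero_state) auto

section \<open>Ergodicity when all service factors are positive\<close>

lemma summable_rate: "rate g n summable_on A"
  using finite_rate_support[of g n] by (intro summable_on_finite_support) (rule rev_finite_subset, auto)

text \<open>A state with positive exit rate in the original network has a positive transition, which
  stays positive under positive \<open>g\<close>; so no state becomes absorbing.\<close>

lemma reversible_chain_rate:
  assumes g: "\<And>i. i \<in> {1..J} \<Longrightarrow> 0 < g i"
    and q1: "\<And>n. n \<in> states J \<Longrightarrow> 0 < qtot (states J) (rate (\<lambda>_. 1)) n"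
  shows "reversible_chain (states J) (rate g) (xi J \<eta> mu)"
proof
  fix n assume n: "n \<in> states J"
  have nonneg: "0 \<le> rate g n m" for m using g by (intro rate_nonneg less_imp_le)
  show "finite {m \<in> states J - {n}. 0 < rate g n m}"
    using finite_rate_support[of g n] by (rule rev_finite_subset) auto
  have "\<exists>m\<in>states J - {n}. rate (\<lambda>_. 1) n m \<noteq> 0"
    using q1[OF n] infsum_0[of "states J - {n}" "rate (\<lambda>_. 1) n"] unfolding qtot_def by force
  then obtain m where m: "m \<in> states J - {n}" "rate (\<lambda>_. 1) n m \<noteq> 0" by blast
  then have "0 < rate (\<lambda>_. 1) n m" using rate_nonneg[of "\<lambda>_. 1" n m] by simp
  then have "0 < rate g n m" by (rule rate_pos[rotated]) (rule g)
  also have "\<dots> \<le> qtot (states J) (rate g) n"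
    unfolding qtot_def using finite_sum_le_infsum[OF summable_rate, of "{m}" "states J - {n}" g n] m nonneg
    by simp
  finally show "0 < qtot (states J) (rate g) n" .
qed (use g in \<open>auto intro!: rate_nonneg xi_pos xi_balance intro: less_imp_le\<close>)

text \<open>Positive transitions of the original network persist, which gives irreducibility.
  Positive recurrence transfers because both chains are reversible for the same summable weight
  \<open>xi\<close> and \<open>g \<le> 1\<close> does not increase any rate.\<close>

lemma ergodic_rate:
  assumes g: "\<And>i. i \<in> {1..J} \<Longrightarrow> 0 < g i \<and> g i \<le> 1"
    and erg: "ergodic_chain (states J) (rate (\<lambda>_. 1))"
  shows "ergodic_chain (states J) (rate g)"
  unfolding ergodic_chain_def
proof (intro conjI ballI)
  show "stable_rates (states J) (rate g)"
    unfolding stable_rates_def using rate_nonneg[of g] g by (auto intro: summable_rate less_imp_le)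
  have "trans_rel (states J) (rate (\<lambda>_. 1)) \<subseteq> trans_rel (states J) (rate g)"
    unfolding trans_rel_def using rate_pos[of g] g by auto
  then show "irreducible_chain (states J) (rate g)"
    using erg rtrancl_mono unfolding ergodic_chain_def irreducible_chain_def by blast
  have q1: "0 < qtot (states J) (rate (\<lambda>_. 1)) n" if "n \<in> states J" for n
    using erg that unfolding ergodic_chain_def pos_recurrent_def by blast
  have one: "reversible_chain (states J) (rate (\<lambda>_. 1)) (xi J \<eta> mu)"
    by (rule reversible_chain_rate) (use q1 in auto)
  have gc: "reversible_chain (states J) (rate g) (xi J \<eta> mu)"
    by (rule reversible_chain_rate) (use q1 g in auto)
  have sum: "xi J \<eta> mu summable_on states J"
    using xi_has_sum by (auto simp: summable_on_def)
  fix n assume n: "n \<in> states J"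
  have "pos_recurrent (states J) (rate (\<lambda>_. 1)) n"
    using erg n by (simp add: ergodic_chain_def)
  then have "reversible_chain.ret (states J) (rate (\<lambda>_. 1)) n \<longlonglongrightarrow> 1"
    by (simp add: reversible_chain.pos_recurrent_iff[OF one n sum])
  then have "reversible_chain.ret (states J) (rate g) n \<longlonglongrightarrow> 1"
    using g by (intro ret_tendsto_1_antimono[OF one gc _ n] rate_mono) (auto intro: less_imp_le)
  then show "pos_recurrent (states J) (rate g) n"
    by (simp add: reversible_chain.pos_recurrent_iff[OF gc n sum])
qed

text \<open>Every rate of a transition that changes coordinate \<open>l\<close> contains the factor
  \<open>g l\<close>, so no positive rate alters a coordinate in \<open>B\<close>.\<close>

lemma closed_fiber:
  assumes "\<And>i. i \<in> B \<Longrightarrow> g i = 0"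
  shows "closed_subspace (states J) (rate g) {n \<in> states J. \<forall>j\<in>B. n j = b j}"
  unfolding closed_subspace_def
proof (intro conjI ballI)
  fix n m
  assume n: "n \<in> {n \<in> states J. \<forall>j\<in>B. n j = b j}"
    and "m \<in> states J - {n \<in> states J. \<forall>j\<in>B. n j = b j}"
  then obtain l where l: "l \<in> B" "m l \<noteq> n l" by auto
  have "g l = 0" using assms l by simp
  moreover have "i = l" if "m = n(i := k)" for i k
    using l that by (auto split: if_splits)
  moreover have "i = l \<or> j = l" if "m = n(j := h, i := k)" for i j h k
    using l that by (auto split: if_splits)
  ultimately show "rate g n m = 0" by (intro rate_eq_0I) blast+
qed auto

lemma not_irreducible_rate:
  assumes l: "l \<in> {1..J}" "g l = 0"
  shows "\<not> irreducible_chain (states J) (rate g)"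
proof
  assume "irreducible_chain (states J) (rate g)"
  moreover have "(\<lambda>_. 0) \<in> states J" "(\<lambda>_. 0)(l := 1) \<in> states J"
    using l by (auto simp: states_def)
  ultimately have path: "((\<lambda>_. 0), (\<lambda>_. 0)(l := 1)) \<in> (trans_rel (states J) (rate g))\<^sup>*"
    by (auto simp: irreducible_chain_def)
  have closed: "closed_subspace (states J) (rate g) {n \<in> states J. \<forall>j\<in>{l}. n j = 0}"
    by (rule closed_fiber) (use l in simp)
  have "(\<lambda>_. 0)(l := 1) \<in> {n \<in> states J. \<forall>j\<in>{l}. n j = (0::nat)}"
    by (rule closed_subspace_rtrancl[OF closed path]) (auto simp: states_def)
  then show False by simp
qed

end

text \<open>Each \<open>b\<close> is itself a state in its own fiber, so distinct \<open>b\<close>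
  have distinct fibers; varying one coordinate in \<open>B\<close> supplies infinitely many.\<close>

lemma infinite_fibers:
  assumes B: "B \<subseteq> {1..J}" "B \<noteq> {}"
  shows "infinite ((\<lambda>b. {n \<in> states J. \<forall>j\<in>B. n j = b j}) ` {b. \<forall>k. k \<notin> B \<longrightarrow> b k = 0})"
proof
  let ?Z = "{b. \<forall>k. k \<notin> B \<longrightarrow> b k = (0::nat)}"
  let ?A = "\<lambda>b. {n \<in> states J. \<forall>j\<in>B. n j = b j}"
  assume "finite (?A ` ?Z)"
  moreover have "inj_on ?A ?Z"
  proof (rule inj_onI)
    fix b c assume b: "b \<in> ?Z" and c: "c \<in> ?Z" and eq: "?A b = ?A c"
    have "b k = 0" if "k \<notin> {1..J}" for k using b B that by blast
    then have "b \<in> ?A b" unfolding states_def by blast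
    with eq have "b \<in> ?A c" by (rule subst)
    show "b = c"
    proof
      fix k
      show "b k = c k" using \<open>b \<in> ?A c\<close> b c by (cases "k \<in> B") auto
    qed
  qed
  ultimately have "finite ?Z" by (rule finite_imageD)
  obtain l where l: "l \<in> B" using B by blast
  have "inj (\<lambda>k::nat. (\<lambda>_. 0::nat)(l := k))" by (intro injI) (metis fun_upd_same)
  moreover have "range (\<lambda>k::nat. (\<lambda>_. 0::nat)(l := k)) \<subseteq> ?Z" using l by auto
  ultimately have "finite (UNIV :: nat set)"
    using \<open>finite ?Z\<close> by (meson finite_imageD finite_subset)
  then show False by simp
qed

lemma Union_fibers:
  "(\<Union>b\<in>{b. \<forall>k. k \<notin> B \<longrightarrow> b k = 0}. {n \<in> states J. \<forall>j\<in>B. n j = b j}) = states J"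
proof (intro equalityI subsetI)
  fix n assume "n \<in> states J"
  then show "n \<in> (\<Union>b\<in>{b. \<forall>k. k \<notin> B \<longrightarrow> b k = 0}. {n \<in> states J. \<forall>j\<in>B. n j = b j})"
    by (intro UN_I[of "restrict_to B n"]) (auto simp: restrict_to_def)
qed auto

text \<open>Positivity propagates along an edge from \<open>a\<close> to \<open>b\<close>: the flow
  \<open>\<eta> a * r a b\<close> is positive and equals \<open>\<eta> b * r b a\<close>, whose
  second factor is nonnegative.\<close>

lemma eta_pos_of_reversible:
  fixes r :: "nat \<Rightarrow> nat \<Rightarrow> real"
  assumes nonneg: "\<forall>i\<in>{0..J}. \<forall>j\<in>{0..J}. r i j \<ge> 0"
    and rev: "\<forall>i\<in>{0..J}. \<forall>j\<in>{0..J}. \<eta> i * r i j = \<eta> j * r j i"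
    and path: "(i, j) \<in> {(a, b). a \<in> {0..J} \<and> b \<in> {0..J} \<and> r a b > 0}\<^sup>*" and i: "0 < \<eta> i"
  shows "0 < \<eta> j"
  using path
proof (induction rule: rtrancl_induct)
  case (step a b)
  then have "0 < \<eta> a * r a b" by simp
  also have "\<dots> = \<eta> b * r b a" using step rev by blast
  finally have "0 < \<eta> b * r b a" .
  moreover have "0 \<le> r b a" using nonneg step.hyps by auto
  ultimately show ?case by (auto simp: zero_less_mult_iff)
qed (rule i)

theorem theorem3p4:
  fixes J :: nat and lam :: "nat \<Rightarrow> real" and mu :: "nat \<Rightarrow> nat \<Rightarrow> real"
    and r :: "nat \<Rightarrow> nat \<Rightarrow> real" and \<eta> :: "nat \<Rightarrow> real" and \<gamma> :: "nat \<Rightarrow> real"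
  defines "L \<equiv> (\<Sum>j\<in>{1..J}. lam j)"
  defines "B \<equiv> {j\<in>{1..J}. \<gamma> j = 0}"
  defines "W \<equiv> {1..J} - B"
  defines "qg \<equiv> jrate J L (rr_mod J r (alpha_of \<gamma>)) mu \<gamma>"
  assumes lam_nonneg: "\<forall>j\<in>{1..J}. lam j \<ge> 0"
    and L_pos: "L > 0"
    and mu_pos: "\<forall>j\<in>{1..J}. \<forall>k. 0 < k \<longrightarrow> mu j k > 0"
    and r_nonneg: "\<forall>i\<in>{0..J}. \<forall>j\<in>{0..J}. r i j \<ge> 0"
    and r_stoch: "\<forall>i\<in>{0..J}. (\<Sum>j\<in>{0..J}. r i j) = 1"
    and r_irred: "\<forall>i\<in>{0..J}. \<forall>j\<in>{0..J}.
                    (i, j) \<in> {(a, b). a \<in> {0..J} \<and> b \<in> {0..J} \<and> r a b > 0}\<^sup>*"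
    and r_0: "\<forall>j\<in>{1..J}. r 0 j = lam j / L" and r_00: "r 0 0 = 0"
    and eta_0: "\<eta> 0 = L"
    and eta_traffic: "\<forall>j\<in>{0..J}. \<eta> j = (\<Sum>i\<in>{0..J}. \<eta> i * r i j)"
    and r_rev: "\<forall>i\<in>{0..J}. \<forall>j\<in>{0..J}. \<eta> i * r i j = \<eta> j * r j i"
    and X_ergodic: "ergodic_chain (states J) (jrate J L r mu (\<lambda>_. 1))"
    and C_fin: "\<forall>j\<in>{1..J}. summable (\<lambda>n. \<Prod>k\<in>{1..n}. \<eta> j / mu j k)"
    and gamma_range: "\<forall>j\<in>{1..J}. 0 \<le> \<gamma> j \<and> \<gamma> j \<le> 1"
  shows "stationary_dist (states J) qg (xi J \<eta> mu)
     \<and> (B = {} \<longrightarrow> ergodic_chain (states J) qg)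
     \<and> (B \<noteq> {} \<longrightarrow>
          \<not> irreducible_chain (states J) qg
        \<and> (\<forall>b\<in>{b. \<forall>k. k \<notin> B \<longrightarrow> b k = 0}.
              closed_subspace (states J) qg {n \<in> states J. \<forall>j\<in>B. n j = b j})
        \<and> (\<Union>b\<in>{b. \<forall>k. k \<notin> B \<longrightarrow> b k = 0}. {n \<in> states J. \<forall>j\<in>B. n j = b j}) = states J
        \<and> infinite ((\<lambda>b. {n \<in> states J. \<forall>j\<in>B. n j = b j}) ` {b. \<forall>k. k \<notin> B \<longrightarrow> b k = 0})
        \<and> (\<forall>\<phi> :: (nat \<Rightarrow> nat) \<Rightarrow> real.
              (\<forall>b\<in>{b. \<forall>k. k \<notin> B \<longrightarrow> b k = 0}. \<phi> b \<ge> 0)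
              \<and> (\<phi> has_sum 1) {b. \<forall>k. k \<notin> B \<longrightarrow> b k = 0}
              \<longrightarrow> stationary_dist (states J) qg (xi_phi W B \<eta> mu \<phi>)))"
proof -
  have eta_pos: "0 < \<eta> j" if "j \<in> {0..J}" for j
    using eta_pos_of_reversible[OF r_nonneg r_rev, of 0 j] r_irred eta_0 L_pos that by auto
  interpret reversible_jackson J L mu r \<eta>
    by standard (use mu_pos r_nonneg eta_pos eta_0 r_rev C_fin in auto)
  have qg: "qg = rate \<gamma>" by (simp add: qg_def rate_def)
  have W: "W \<subseteq> {1..J}" "W \<inter> B = {}" "W \<union> B = {1..J}" and B: "B \<subseteq> {1..J}"
    by (auto simp: W_def B_def)
  have B0: "\<gamma> j = 0" if "j \<in> B" for j using that by (simp add: B_def)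
  have "ergodic_chain (states J) (rate \<gamma>)" if "B = {}"
  proof (rule ergodic_rate)
    show "0 < \<gamma> i \<and> \<gamma> i \<le> 1" if "i \<in> {1..J}" for i
      using \<open>B = {}\<close> gamma_range that by (force simp: B_def)
    show "ergodic_chain (states J) (rate (\<lambda>_. 1))" using X_ergodic by (simp add: rate_one)
  qed
  moreover have "\<not> irreducible_chain (states J) (rate \<gamma>)" if "B \<noteq> {}"
    using that not_irreducible_rate[of _ \<gamma>] by (auto simp: B_def)
  moreover have "closed_subspace (states J) (rate \<gamma>) {n \<in> states J. \<forall>j\<in>B. n j = b j}" for b
    by (rule closed_fiber) (rule B0)
  moreover have "stationary_dist (states J) (rate \<gamma>) (xi_phi W B \<eta> mu \<phi>)"
    if "(\<forall>b\<in>{b. \<forall>k. k \<notin> B \<longrightarrow> b k = 0}. \<phi> b \<ge> 0)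
      \<and> (\<phi> has_sum 1) {b. \<forall>k. k \<notin> B \<longrightarrow> b k = 0}" for \<phi>
    using that by (intro stationary_xi_phi[OF W] B0) auto
  ultimately show ?thesis
    unfolding qg using stationary_xi[of \<gamma>] infinite_fibers[OF B] Union_fibers[where B = B and J = J] by blast
qed

end
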